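(* Consider the asynchronous iteration with stepsize $\gamma>0$ described in the context, applied to the pose graph optimization problem $\min_{x\in\mathcal M} f(x)$ (either the maximum likelihood problem or its rank-$r$ relaxation), with $n$ robots, robot-level graph of maximum degree $\Delta>0$, and constants $L$ and $\alpha$ as in the context. Let $f^\star$ be any global lower bound on $f$ over $\mathcal M$, and let $\rho = \Delta/n$. Assume bounded delay: there is a constant $B\ge 0$ such that all delays in the iteration are at most $B$. Let $\bar\gamma>0$ be an upper bound on the stepsize that satisfies $$2\rho\alpha^2B^2L^2\bar\gamma^2 + L\bar\gamma - 1 \le 0. \qquad ( * )$$ In particular, the following choice of $\bar\gamma$ satisfies $( * )$: $$\bar\gamma = \begin{cases} \dfrac{\sqrt{1+8\rho\alpha^2B^2}-1}{4\rho\alpha^2B^2L}, & B>0,\\[2mm] 1/L, & B=0.\end{cases}$$ If $0<\gamma\le\bar\gamma$, then the iteration converges to a first-order critical point (a point where $\operatorname{grad} f=0$) with global sublinear rate, in the following sense: for every number $K\ge 1$ of total update steps and every initial point $x^0\in\mathcal M$, $$\min_{k\in\{0,\dots,K-1\}} \mathbb E_{i_0,\dots,i_{K-1}}\Big[\|\operatorname{grad} f(x^k)\|^2\Big] \le \frac{2n\,(f(x^0)-f^\star)}{\gamma K}.$$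
   Context: **Problem.** Let $\mathcal R=\{1,\dots,n\}$ be a set of robots, where robot $i$ owns $n_i$ poses $i_1,\dots,i_{n_i}$; let $d\in\{2,3\}$ and $r\ge d$. A pose graph $G=(V,E)$ has as vertices all poses of all robots, and each edge $(i_\tau,j_s)\in E$ carries a relative measurement $(\widetilde R^{i_\tau}_{j_s},\widetilde t^{i_\tau}_{j_s})\in \mathrm{SO}(d)\times\mathbb R^d$. Let $w_R,w_t>0$. The cost is $$f=\sum_{(i_\tau,j_s)\in E} w_R\|Y_{j_s}-Y_{i_\tau}\widetilde R^{i_\tau}_{j_s}\|_F^2 + w_t\|p_{j_s}-p_{i_\tau}-Y_{i_\tau}\widetilde t^{i_\tau}_{j_s}\|_2^2 .$$ In the maximum likelihood problem, $Y_{i_\tau}\in\mathrm{SO}(d)$ and $p_{i_\tau}\in\mathbb R^d$. In the rank-$r$ relaxation, $Y_{i_\tau}\in\mathrm{St}(d,r)=\{Y\in\mathbb R^{r\times d}:Y^\top Y=I_d\}$ and $p_{i_\tau}\in\mathbb R^r$. Let $x_i=[Y_{i_1}\ p_{i_1}\ \cdots\ Y_{i_{n_i}}\ p_{i_{n_i}}]$ collect all variables of robot $i$. Then $x_i\in\mathcal M_i$, with $\mathcal M_i=(\mathrm{SO}(d)\times\mathbb R^d)^{n_i}$ or $\mathcal M_i=(\mathrm{St}(d,r)\times\mathbb R^r)^{n_i}$ respectively, and $x=(x_1,\dots,x_n)\in\mathcal M=\mathcal M_1\times\cdots\times\mathcal M_n$. **Robot-level graph.** The graph $G_{\mathcal R}=(\mathcal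 R,E_{\mathcal R})$ joins two distinct robots $i,j$ iff some measurement in $E$ is between a pose of $i$ and a pose of $j$. $\mathrm N(i)$ is the set of neighbors of $i$ in $G_{\mathcal R}$, and $\Delta$ is its maximum degree. Grouping the terms of the cost by robots gives $$f(x)=\sum_{(i,j)\in E_{\mathcal R}} f_{ij}(x_i,x_j)+\sum_{i\in\mathcal R}h_i(x_i),$$ where $f_{ij}$ sums the terms of measurements between robots $i$ and $j$, and $h_i$ sums the terms of measurements within robot $i$. **Riemannian notation.** Each $\mathcal M_i$ is a submanifold of its ambient Euclidean matrix space; tangent spaces carry the Frobenius inner product and $\|\cdot\|$ is the induced norm. $\operatorname{grad}$ is the Riemannian gradient (the orthogonal projection of the Euclidean gradient onto the tangent space), and $\operatorname{grad}_i f$ is its component in $T_{x_i}\mathcal M_i$. $\mathrm{Retr}_{x_i}:T_{x_i}\mathcal M_i\to\mathcal M_i$ is a fixed retraction, and $\mathrm{Retr}_x$ is the product retraction on $\mathcal M$. **Constants.** $L$ is a constant such that for all $x\in\mathcal M$ and $\eta\in T_x\mathcal M$, $$\big|f(\mathrm{Retr}_x(\eta))-f(x)-\langle\eta,\operatorname{grad} f(x)\rangle\big|\le \tfrac L2\|\eta\|^2,$$ and $L\ge C$, where $C>0$ is the Lipschitz constant of the Euclidean gradient of $f$ on the ambient space. $\alpha>0$ is a constant such that $\|\mathrm{Retr}_{x_i}(\eta_i)-x_i\|\le\alpha\|\eta_i\|$ for all $i\in\mathcal R$, $x_i\in\mathcal M_i$, $\eta_i\in T_{x_i}\mathcal M_i$.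 **Asynchronous iteration (global view of ASAPP).** Given $x^0\in\mathcal M$ and $\gamma>0$, for $k=0,1,2,\dots$: 1. select $i_k\in\mathcal R$ uniformly at random, the $i_k$ being i.i.d.; 2. set $\hat x_{i_k}=x_{i_k}^k$, and for each neighbor $j\in\mathrm N(i_k)$ set $\hat x_j=x_j^{k-B_k(j)}$, where the integer $B_k(j)\ge0$ is the delay; 3. set $\eta^k_{i_k}=\operatorname{grad} g_{i_k}(\hat x_{i_k})\in T_{\hat x_{i_k}}\mathcal M_{i_k}$, where $g_{i_k}(y)=h_{i_k}(y)+\sum_{j\in \mathrm N(i_k)}f_{i_kj}(y,\hat x_j)$, and set $\eta^k_j=0$ for $j\ne i_k$; 4. set $x_{i_k}^{k+1}=\mathrm{Retr}_{\hat x_{i_k}}(-\gamma\eta^k_{i_k})$ and $x_j^{k+1}=x_j^k$ for $j\neq i_k$. Conventions: $B_k(j)\le k$; and the delays are such that $x^k$ is determined by $x^0$ and $i_0,\dots,i_{k-1}$. Bounded delay means $B_k(j)\le B$ for all $k$ and all $j\in\mathrm N(i_k)$. *)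

theory Defs
  imports "HOL-Probability.Probability"
begin

section \<open>Embedded submanifolds of Euclidean space\<close>

(* Velocities at x of C1 curves lying in M. *)
definition tangent_space :: "'a::euclidean_space set \<Rightarrow> 'a \<Rightarrow> 'a set" where
  "tangent_space M x =
     {v. \<exists>c e. e > 0 \<and> c C1_differentiable_on {-e<..<e} \<and> c ` {-e<..<e} \<subseteq> M \<and>
            c 0 = x \<and> (c has_vector_derivative v) (at (0::real))}"

definition tangent_bundle :: "'a::euclidean_space set \<Rightarrow> ('a \<times> 'a) set" where
  "tangent_bundle M = {(x, v). x \<in> M \<and> v \<in> tangent_space M x}"

definition euclidean_grad :: "('a::euclidean_space \<Rightarrow> real) \<Rightarrow> 'a \<Rightarrow> 'a" where
  "euclidean_grad f x = (THE D. GDERIV f x :> D)"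

definition orth_proj :: "'a::euclidean_space set \<Rightarrow> 'a \<Rightarrow> 'a" where
  "orth_proj T v = (THE p. p \<in> T \<and> (\<forall>w\<in>T. (v - p) \<bullet> w = 0))"

definition riemannian_grad :: "'a::euclidean_space set \<Rightarrow> ('a \<Rightarrow> real) \<Rightarrow> 'a \<Rightarrow> 'a" where
  "riemannian_grad M f x = orth_proj (tangent_space M x) (euclidean_grad f x)"

(* Only meant for open U; in finite dimension, C^k is equivalent to all directional
   derivatives existing and being of class C^(k-1). *)
primrec Ck_on :: "nat \<Rightarrow> ('a::euclidean_space \<Rightarrow> 'b::euclidean_space) \<Rightarrow> 'a set \<Rightarrow> bool" where
  "Ck_on 0 f U \<longleftrightarrow> continuous_on U f"
| "Ck_on (Suc k) f U \<longleftrightarrow>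
     (\<forall>x\<in>U. f differentiable (at x)) \<and>
     (\<forall>h. Ck_on k (\<lambda>x. frechet_derivative f (at x) h) U)"

(* Smoothness on a subset of Euclidean space: local extendability to a smooth map. *)
definition smooth_map_on :: "('a::euclidean_space \<Rightarrow> 'b::euclidean_space) \<Rightarrow> 'a set \<Rightarrow> bool" where
  "smooth_map_on f A \<longleftrightarrow>
     (\<forall>a\<in>A. \<exists>U F. open U \<and> a \<in> U \<and> (\<forall>k. Ck_on k F U) \<and> (\<forall>b\<in>A \<inter> U. F b = f b))"

(* Retraction in the sense of optimization on manifolds (not the topological notion
   retraction of HOL-Analysis); only the values on the tangent bundle matter. *)
definition manifold_retraction :: "'a::euclidean_space set \<Rightarrow> ('a \<Rightarrow> 'a \<Rightarrow> 'a) \<Rightarrow> bool" where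
  "manifold_retraction M R \<longleftrightarrow>
     smooth_map_on (\<lambda>(x, v). R x v) (tangent_bundle M) \<and>
     (\<forall>x\<in>M. \<forall>v\<in>tangent_space M x. R x v \<in> M) \<and>
     (\<forall>x\<in>M. R x 0 = x) \<and>
     (\<forall>x\<in>M. \<forall>v\<in>tangent_space M x.
        ((\<lambda>t. R x (t *\<^sub>R v)) has_vector_derivative v) (at (0::real)))"


section \<open>Pose graphs and the cost\<close>

(* 'v indexes all poses of all robots, 'n the robots; the poses of robot i are the v with
   robot_of v = i.  Matrices in R^(r x d) have type real^'d^'r. *)
record ('v, 'n, 'd::finite) pose_graph =
  robot_of :: "'v \<Rightarrow> 'n"
  edges :: "('v \<times> 'v) set"
  rel_rot :: "'v \<Rightarrow> 'v \<Rightarrow> real^'d^'d"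
  rel_trans :: "'v \<Rightarrow> 'v \<Rightarrow> real^'d"
  w_rot :: real
  w_trans :: real

definition valid_pose_graph :: "('v, 'n, 'd::finite) pose_graph \<Rightarrow> bool" where
  "valid_pose_graph G \<longleftrightarrow>
     w_rot G > 0 \<and> w_trans G > 0 \<and> (\<forall>(u, v)\<in>edges G. rotation_matrix (rel_rot G u v))"

(* The component at v is (Y_v, p_v).  The norm is the Frobenius (i.e. Euclidean) norm of all
   entries. *)
type_synonym ('d, 'r, 'v) config = "((real^'d^'r) \<times> (real^'r))^'v"

definition edge_cost ::
  "('v, 'n, 'd::finite) pose_graph \<Rightarrow> 'v \<Rightarrow> 'v \<Rightarrow> ('d, 'r::finite, 'v::finite) config \<Rightarrow> real" where
  "edge_cost G u v x =
     w_rot G * (norm (fst (x $ v) - fst (x $ u) ** rel_rot G u v))\<^sup>2 +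
     w_trans G * (norm (snd (x $ v) - snd (x $ u) - fst (x $ u) *v rel_trans G u v))\<^sup>2"

definition cost ::
  "('v, 'n, 'd::finite) pose_graph \<Rightarrow> ('d, 'r::finite, 'v::finite) config \<Rightarrow> real" where
  "cost G x = (\<Sum>(u, v)\<in>edges G. edge_cost G u v x)"


section \<open>Manifolds\<close>

definition special_orthogonal :: "(real^'d^'d::finite) set" where
  "special_orthogonal = {Y. rotation_matrix Y}"

definition stiefel :: "(real^'d^'r::finite) set" where
  "stiefel = {Y. transpose Y ** Y = mat 1}"

(* The variable x_i of robot i is represented inside the joint ambient space, by zeroing the
   components of all other robots. *)
definition block ::
  "('v, 'n, 'd::finite) pose_graph \<Rightarrow> 'n \<Rightarrow> ('d::finite, 'r::finite, 'v::finite) config \<Rightarrow> ('d, 'r, 'v) config" where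
  "block G i x = (\<chi> v. if robot_of G v = i then x $ v else 0)"

(* Q is the set in which the matrices Y range (special_orthogonal or stiefel). *)
definition robot_manifold ::
  "('v, 'n, 'd::finite) pose_graph \<Rightarrow> (real^'d^'r) set \<Rightarrow> 'n \<Rightarrow> ('d::finite, 'r::finite, 'v::finite) config set" where
  "robot_manifold G Q i =
     {z. \<forall>v. if robot_of G v = i then fst (z $ v) \<in> Q else z $ v = 0}"

definition joint_manifold ::
  "('v, 'n, 'd::finite) pose_graph \<Rightarrow> (real^'d^'r) set \<Rightarrow> ('d::finite, 'r::finite, 'v::finite) config set" where
  "joint_manifold G Q = {x. \<forall>i. block G i x \<in> robot_manifold G Q i}"

definition product_retr ::
  "('v, 'n::finite, 'd::finite) pose_graph \<Rightarrow>
   ('n \<Rightarrow> ('d::finite, 'r::finite, 'v::finite) config \<Rightarrow> ('d, 'r, 'v) config \<Rightarrow> ('d, 'r, 'v) config) \<Rightarrow>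
   ('d, 'r, 'v) config \<Rightarrow> ('d, 'r, 'v) config \<Rightarrow> ('d, 'r, 'v) config" where
  "product_retr G Retr x \<eta> = (\<Sum>i\<in>UNIV. Retr i (block G i x) (block G i \<eta>))"


section \<open>Robot-level graph and grouping of the cost\<close>

definition edges_between :: "('v, 'n, 'd::finite) pose_graph \<Rightarrow> 'n \<Rightarrow> 'n \<Rightarrow> ('v \<times> 'v) set" where
  "edges_between G i j = {(u, v). (u, v) \<in> edges G \<and> {robot_of G u, robot_of G v} = {i, j}}"

definition neighbors :: "('v, 'n, 'd::finite) pose_graph \<Rightarrow> 'n \<Rightarrow> 'n set" where
  "neighbors G i = {j. j \<noteq> i \<and> edges_between G i j \<noteq> {}}"

definition max_degree :: "('v, 'n::finite, 'd::finite) pose_graph \<Rightarrow> nat" where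
  "max_degree G = (MAX i. card (neighbors G i))"

definition inter_cost ::
  "('v, 'n, 'd::finite) pose_graph \<Rightarrow> 'n \<Rightarrow> 'n \<Rightarrow>
   ('d, 'r::finite, 'v::finite) config \<Rightarrow> ('d, 'r, 'v) config \<Rightarrow> real" where
  "inter_cost G i j y z =
     (\<Sum>(u, v)\<in>edges_between G i j. edge_cost G u v (block G i y + block G j z))"

definition intra_cost ::
  "('v, 'n, 'd::finite) pose_graph \<Rightarrow> 'n \<Rightarrow> ('d, 'r::finite, 'v::finite) config \<Rightarrow> real" where
  "intra_cost G i y = (\<Sum>(u, v)\<in>edges_between G i i. edge_cost G u v (block G i y))"

(* g_i, given the copies xh j of the variables of the neighbors j. *)
definition local_cost ::
  "('v, 'n, 'd::finite) pose_graph \<Rightarrow> 'n \<Rightarrow> ('n \<Rightarrow> ('d, 'r::finite, 'v::finite) config) \<Rightarrow>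
   ('d, 'r, 'v) config \<Rightarrow> real" where
  "local_cost G i xh y = intra_cost G i y + (\<Sum>j\<in>neighbors G i. inter_cost G i j y (xh j))"


section \<open>Constants\<close>

definition descent_constant ::
  "('v, 'n::finite, 'd::finite) pose_graph \<Rightarrow> (real^'d^'r) set \<Rightarrow>
   ('n \<Rightarrow> ('d::finite, 'r::finite, 'v::finite) config \<Rightarrow> ('d, 'r, 'v) config \<Rightarrow> ('d, 'r, 'v) config) \<Rightarrow>
   real \<Rightarrow> bool" where
  "descent_constant G Q Retr L \<longleftrightarrow>
     (\<forall>x\<in>joint_manifold G Q. \<forall>\<eta>\<in>tangent_space (joint_manifold G Q) x.
        \<bar>cost G (product_retr G Retr x \<eta>) - cost G x
          - \<eta> \<bullet> riemannian_grad (joint_manifold G Q) (cost G) x\<bar> \<le> L / 2 * (norm \<eta>)\<^sup>2) \<and>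
     (\<exists>C>0. C \<le> L \<and>
        C-lipschitz_on UNIV (euclidean_grad (cost G :: ('d, 'r, 'v) config \<Rightarrow> real)))"

definition retr_bound ::
  "('v, 'n, 'd::finite) pose_graph \<Rightarrow> (real^'d^'r) set \<Rightarrow>
   ('n \<Rightarrow> ('d::finite, 'r::finite, 'v::finite) config \<Rightarrow> ('d, 'r, 'v) config \<Rightarrow> ('d, 'r, 'v) config) \<Rightarrow>
   real \<Rightarrow> bool" where
  "retr_bound G Q Retr \<alpha> \<longleftrightarrow>
     (\<forall>i. \<forall>z\<in>robot_manifold G Q i. \<forall>\<eta>\<in>tangent_space (robot_manifold G Q i) z.
        norm (Retr i z \<eta> - z) \<le> \<alpha> * norm \<eta>)"


section \<open>The asynchronous iteration\<close>

definition iid_uniform :: "'w measure \<Rightarrow> (nat \<Rightarrow> 'w \<Rightarrow> 'n::finite) \<Rightarrow> bool" where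
  "iid_uniform P idx \<longleftrightarrow>
     prob_space P \<and>
     prob_space.indep_vars P (\<lambda>_. count_space UNIV) idx UNIV \<and>
     (\<forall>k. distr P (count_space UNIV) (idx k) = uniform_count_measure UNIV)"

(* delay k j w is B_k(j) and x k w is x^k, both at the outcome w.  The last conjunct says that
   x^k is determined by x^0 and i_0, ..., i_(k-1); the delays may otherwise depend on w. *)
definition asapp_iteration ::
  "('v, 'n, 'd::finite) pose_graph \<Rightarrow> (real^'d^'r) set \<Rightarrow>
   ('n \<Rightarrow> ('d::finite, 'r::finite, 'v::finite) config \<Rightarrow> ('d, 'r, 'v) config \<Rightarrow> ('d, 'r, 'v) config) \<Rightarrow>
   real \<Rightarrow> 'w set \<Rightarrow> (nat \<Rightarrow> 'w \<Rightarrow> 'n) \<Rightarrow> (nat \<Rightarrow> 'n \<Rightarrow> 'w \<Rightarrow> nat) \<Rightarrow>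
   ('d, 'r, 'v) config \<Rightarrow> (nat \<Rightarrow> 'w \<Rightarrow> ('d, 'r, 'v) config) \<Rightarrow> bool" where
  "asapp_iteration G Q Retr \<gamma> \<Omega> idx delay x0 x \<longleftrightarrow>
     (\<forall>w\<in>\<Omega>. x 0 w = x0) \<and>
     (\<forall>w\<in>\<Omega>. \<forall>k. \<forall>j\<in>neighbors G (idx k w). delay k j w \<le> k) \<and>
     (\<forall>w\<in>\<Omega>. \<forall>k.
        let i = idx k w;
            xh = (\<lambda>j. block G j (x (k - delay k j w) w));
            xi = block G i (x k w);
            \<eta> = riemannian_grad (robot_manifold G Q i) (local_cost G i xh) xi
        in block G i (x (Suc k) w) = Retr i xi (- \<gamma> *\<^sub>R \<eta>) \<and>
           (\<forall>j. j \<noteq> i \<longrightarrow> block G j (x (Suc k) w) = block G j (x k w))) \<and>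
     (\<forall>k. \<forall>w\<in>\<Omega>. \<forall>w'\<in>\<Omega>. (\<forall>l<k. idx l w = idx l w') \<longrightarrow> x k w = x k w')"

definition bounded_delay ::
  "('v, 'n, 'd::finite) pose_graph \<Rightarrow> 'w set \<Rightarrow> (nat \<Rightarrow> 'w \<Rightarrow> 'n) \<Rightarrow> (nat \<Rightarrow> 'n \<Rightarrow> 'w \<Rightarrow> nat) \<Rightarrow> real \<Rightarrow> bool" where
  "bounded_delay G \<Omega> idx delay B \<longleftrightarrow>
     (\<forall>w\<in>\<Omega>. \<forall>k. \<forall>j\<in>neighbors G (idx k w). real (delay k j w) \<le> B)"

end

theory Submission
  imports Defs
begin

text \<open>
  The proof is a descent argument in which the error caused by delays is paid for by the movement
  of the iterates.

  Let robot \<open>i\<close> move from \<open>x\<close> to \<open>x'\<close> along \<open>\<eta>\<close>, the gradient of its local cost. The local cost equals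
  the joint cost, up to a constant, at the configuration in which the neighbours of \<open>i\<close> are replaced by
  their outdated copies. Therefore \<open>\<eta>\<close> differs from block \<open>i\<close> of \<open>grad f(x)\<close> by at most \<open>L\<close> times
  the distance between outdated and current neighbours (\<open>local_riemannian_grad_error\<close>), and the
  descent inequality yields (\<open>asynchronous_block_step\<close>)
  \<open>f(x') \<le> f(x) - \<gamma>/2 \<parallel>grad\<^sub>i f(x)\<parallel>\<^sup>2 - a \<parallel>x' - x\<parallel>\<^sup>2 + \<gamma>/2 L\<^sup>2 (delay error)\<close>
  with \<open>a = (1 - L \<gamma>) / (2 \<gamma> \<alpha>\<^sup>2)\<close>. The delay error of a neighbour is a sum of at most \<open>B\<close> past
  displacements, those in which that neighbour moved (\<open>stale_copy_error\<close>).

  The robot that moves is uniformly distributed and independent of the past. Hence the expectation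
  of the squared gradient block is \<open>1/n\<close> times that of the squared full gradient, and a past
  displacement was made by a neighbour of the present mover with conditional probability at most
  \<open>\<rho> = \<Delta>/n\<close>. Summed over time, a displacement is charged with total weight at most
  \<open>\<gamma>/2 L\<^sup>2 B\<^sup>2 \<rho>\<close>, which the step size condition keeps below \<open>a\<close>. The telescoped inequality bounds
  the sum of the expected squared gradients, and the minimum is at most the mean
  (\<open>asynchronous_rate\<close>, \<open>asapp_rate\<close>).

  All of this requires that Riemannian gradients make sense: the orthogonal projection exists because
  the tangent spaces, defined as velocities of curves, are linear subspaces. For rotations this follows
  from the group structure, for orthonormal frames from the action of the orthogonal group, and for
  the manifolds of the robots from their product structure.
\<close>

section \<open>Tangent vectors as velocities of curves\<close>

lemma bounded_bilinear_matrix_mult: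
  "bounded_bilinear ((**) :: real^'b^'a \<Rightarrow> real^'c^'b \<Rightarrow> real^'c^'a)"
proof -
  have "bilinear ((**) :: real^'b^'a \<Rightarrow> real^'c^'b \<Rightarrow> real^'c^'a)"
    unfolding bilinear_def
    by (intro conjI allI linearI)
      (simp_all add: vec_eq_iff matrix_matrix_mult_def sum.distrib sum_distrib_left algebra_simps)
  then show ?thesis
    by (simp add: bilinear_conv_bounded_bilinear)
qed

lemma linear_transpose: "linear (transpose :: real^'b^'a \<Rightarrow> real^'a^'b)"
  by (intro linearI) (simp_all add: vec_eq_iff transpose_def)

lemma tangent_spaceI:
  assumes "e > 0" "\<And>t. \<bar>t\<bar> < e \<Longrightarrow> c t \<in> M" "c 0 = x" "D 0 = v"
    and "\<And>t. \<bar>t\<bar> < e \<Longrightarrow> (c has_vector_derivative D t) (at t)"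
    and "continuous_on {-e<..<e} D"
  shows "v \<in> tangent_space M x"
  unfolding tangent_space_def C1_differentiable_on_def
  using assms by (intro CollectI exI[of _ c] exI[of _ e]) (auto intro!: exI[of _ D])

lemma tangent_spaceE:
  assumes "v \<in> tangent_space M x"
  obtains c D e where "e > 0" "\<And>t. \<bar>t\<bar> < e \<Longrightarrow> c t \<in> M" "c 0 = x" "D 0 = v"
    "\<And>t. \<bar>t\<bar> < e \<Longrightarrow> (c has_vector_derivative D t) (at t)"
    "continuous_on {-e<..<e} D"
proof -
  obtain c e D where *: "e > 0" "c ` {-e<..<e} \<subseteq> M" "c 0 = x"
      "(c has_vector_derivative v) (at 0)"
      "\<And>t. t \<in> {-e<..<e} \<Longrightarrow> (c has_vector_derivative D t) (at t)"
      "continuous_on {-e<..<e} D"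
    using assms unfolding tangent_space_def C1_differentiable_on_def by blast
  have "D 0 = v"
    using vector_derivative_unique_at[OF *(4) *(5)[of 0]] * by simp
  then show ?thesis
    using * that[of e c D] by (auto simp: image_subset_iff abs_less_iff)
qed

lemma tangent_space_zero: "x \<in> M \<Longrightarrow> 0 \<in> tangent_space M x"
  by (rule tangent_spaceI[of 1 "\<lambda>_. x" _ _ "\<lambda>_. 0"]) auto

lemma tangent_space_scaleR:
  assumes "v \<in> tangent_space M x"
  shows "a *\<^sub>R v \<in> tangent_space M x"
proof -
  obtain c D e where c: "e > 0" "\<And>t. \<bar>t\<bar> < e \<Longrightarrow> c t \<in> M" "c 0 = x" "D 0 = v"
    "\<And>t. \<bar>t\<bar> < e \<Longrightarrow> (c has_vector_derivative D t) (at t)" "continuous_on {-e<..<e} D"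
    using tangent_spaceE[OF assms] by metis
  \<comment> \<open>the added \<open>1\<close> covers \<open>a = 0\<close>\<close>
  define \<epsilon> where "\<epsilon> = e / (\<bar>a\<bar> + 1)"
  have small: "\<bar>a * t\<bar> < e" if "\<bar>t\<bar> < \<epsilon>" for t
  proof -
    have "\<bar>a * t\<bar> \<le> (\<bar>a\<bar> + 1) * \<bar>t\<bar>"
      by (simp add: abs_mult mult_right_mono)
    also have "\<dots> < (\<bar>a\<bar> + 1) * \<epsilon>"
      using that by (intro mult_strict_left_mono) auto
    also have "\<dots> = e"
      by (simp add: \<epsilon>_def add_nonneg_eq_0_iff)
    finally show ?thesis .
  qed
  show ?thesis
  proof (rule tangent_spaceI[of \<epsilon> "\<lambda>t. c (a * t)" _ _ "\<lambda>t. a *\<^sub>R D (a * t)"])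
    show "\<epsilon> > 0"
      using c(1) by (simp add: \<epsilon>_def add_nonneg_pos)
    show "((\<lambda>t. c (a * t)) has_vector_derivative a *\<^sub>R D (a * t)) (at t)" if "\<bar>t\<bar> < \<epsilon>" for t
    proof -
      have "((*) a has_vector_derivative a) (at t)"
        by (auto intro!: derivative_eq_intros)
      from vector_diff_chain_at[OF this c(5)[OF small[OF that]]] show ?thesis
        by (simp add: o_def)
    qed
    show "continuous_on {-\<epsilon><..<\<epsilon>} (\<lambda>t. a *\<^sub>R D (a * t))"
      using small
      by (intro continuous_intros continuous_on_compose2[OF c(6)])
        (auto simp: image_subset_iff, (smt (verit))+)
  qed (use c small in auto)
qed

text \<open>This is the product rule read off on curves. With matrix multiplication it multiplies curves inside
  a matrix group; with one factor frozen it moves curves from one set to another.\<close>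

lemma tangent_space_bilinear_image:
  assumes h: "bounded_bilinear h"
    and M: "\<And>a b. a \<in> M1 \<Longrightarrow> b \<in> M2 \<Longrightarrow> h a b \<in> M"
    and v: "v \<in> tangent_space M1 x" and w: "w \<in> tangent_space M2 y"
  shows "h x w + h v y \<in> tangent_space M (h x y)"
proof -
  interpret bounded_bilinear h by (fact h)
  obtain c D e where c: "e > 0" "\<And>t. \<bar>t\<bar> < e \<Longrightarrow> c t \<in> M1" "c 0 = x" "D 0 = v"
    "\<And>t. \<bar>t\<bar> < e \<Longrightarrow> (c has_vector_derivative D t) (at t)" "continuous_on {-e<..<e} D"
    using tangent_spaceE[OF v] by metis
  obtain c' D' e' where c': "e' > 0" "\<And>t. \<bar>t\<bar> < e' \<Longrightarrow> c' t \<in> M2" "c' 0 = y" "D' 0 = w"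
    "\<And>t. \<bar>t\<bar> < e' \<Longrightarrow> (c' has_vector_derivative D' t) (at t)" "continuous_on {-e'<..<e'} D'"
    using tangent_spaceE[OF w] by metis
  have cont: "continuous_on {-min e e'<..<min e e'} c" "continuous_on {-min e e'<..<min e e'} c'"
    by (rule continuous_on_vector_derivative, rule has_vector_derivative_at_within,
        rule c(5) c'(5), force)+
  show ?thesis
  proof (rule tangent_spaceI[of "min e e'" "\<lambda>t. h (c t) (c' t)" _ _
        "\<lambda>t. h (c t) (D' t) + h (D t) (c' t)"])
    show "((\<lambda>t. h (c t) (c' t)) has_vector_derivative h (c t) (D' t) + h (D t) (c' t)) (at t)"
      if "\<bar>t\<bar> < min e e'" for t
      using that by (intro has_vector_derivative c c') auto
    show "continuous_on {-min e e'<..<min e e'} (\<lambda>t. h (c t) (D' t) + h (D t) (c' t))"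
      by (intro continuous_intros continuous_on cont continuous_on_subset[OF c(6)]
          continuous_on_subset[OF c'(6)]) auto
  qed (use c c' M in auto)
qed

text \<open>A linear map is a bilinear one whose first factor is frozen at the single scalar \<open>1\<close>.\<close>

lemma tangent_space_linear_image:
  fixes h :: "'a::euclidean_space \<Rightarrow> 'b::euclidean_space"
  assumes h: "linear h" and M: "\<And>a. a \<in> M1 \<Longrightarrow> h a \<in> M"
    and v: "v \<in> tangent_space M1 x"
  shows "h v \<in> tangent_space M (h x)"
proof -
  have "bounded_bilinear (\<lambda>(r::real) a. r *\<^sub>R h a)"
    unfolding bilinear_conv_bounded_bilinear[symmetric] bilinear_def
    by (auto intro!: linearI simp: linear_add[OF h] linear_scale[OF h] algebra_simps)
  moreover have "0 \<in> tangent_space {1::real} 1"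
    by (intro tangent_space_zero) simp
  ultimately have "1 *\<^sub>R h v + 0 *\<^sub>R h x \<in> tangent_space M (1 *\<^sub>R h x)"
    using M v by (intro tangent_space_bilinear_image[where ?M1.0="{1}" and ?M2.0=M1]) auto
  then show ?thesis by simp
qed

section \<open>Rotations and orthonormal frames\<close>

text \<open>Velocities of curves in an arbitrary set need not be closed under addition. In a group they are:
  if \<open>c\<^sub>1\<close> and \<open>c\<^sub>2\<close> both start at \<open>Y\<close>, then \<open>c\<^sub>1 Y\<^sup>T c\<^sub>2\<close> is again a curve in the group that starts at
  \<open>Y\<close>, and its velocity is the sum of the two velocities. This covers the special orthogonal group
  as well as the full orthogonal group.\<close>

lemma subspace_tangent_space_matrix_group:
  fixes \<Gamma> :: "(real^'d^'d) set"
  assumes orth: "\<And>A. A \<in> \<Gamma> \<Longrightarrow> orthogonal_matrix A"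
    and mult: "\<And>A B. A \<in> \<Gamma> \<Longrightarrow> B \<in> \<Gamma> \<Longrightarrow> A ** B \<in> \<Gamma>"
    and inv: "\<And>A. A \<in> \<Gamma> \<Longrightarrow> transpose A \<in> \<Gamma>"
    and Y: "Y \<in> \<Gamma>"
  shows "subspace (tangent_space \<Gamma> Y)"
proof (rule subspaceI)
  show "0 \<in> tangent_space \<Gamma> Y"
    by (rule tangent_space_zero[OF Y])
  show "a *\<^sub>R v \<in> tangent_space \<Gamma> Y" if "v \<in> tangent_space \<Gamma> Y" for a v
    by (rule tangent_space_scaleR[OF that])
  fix v w assume vw: "v \<in> tangent_space \<Gamma> Y" "w \<in> tangent_space \<Gamma> Y"
  interpret bounded_bilinear "(**) :: real^'d^'d \<Rightarrow> real^'d^'d \<Rightarrow> real^'d^'d"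
    by (rule bounded_bilinear_matrix_mult)
  have YY: "transpose Y ** Y = mat 1" "Y ** transpose Y = mat 1"
    using orth[OF Y] by (auto simp: orthogonal_matrix_def)
  have "transpose Y ** w \<in> tangent_space \<Gamma> (transpose Y ** Y)"
    using vw(2) mult inv Y
    by (intro tangent_space_linear_image[where h="(**) (transpose Y)" and ?M1.0=\<Gamma>]
        bounded_linear.linear bounded_linear_right) auto
  from tangent_space_bilinear_image[OF bounded_bilinear_matrix_mult mult vw(1) this]
  show "v + w \<in> tangent_space \<Gamma> Y"
    by (simp add: matrix_mul_assoc YY add.commute)
qed

lemma subspace_tangent_space_special_orthogonal:
  assumes "Y \<in> (special_orthogonal :: (real^'d^'d) set)"
  shows "subspace (tangent_space special_orthogonal Y)"
  using assms
  by (intro subspace_tangent_space_matrix_group)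
    (auto simp: special_orthogonal_def rotation_matrix_def orthogonal_matrix_mul det_mul
      orthogonal_matrix_transpose)

definition outer :: "real^'n \<Rightarrow> real^'m \<Rightarrow> real^'m^'n" where
  "outer u v = (\<chi> i j. u $ i * v $ j)"

lemma outer_mult: "outer u v ** outer x y = (v \<bullet> x) *\<^sub>R outer u y"
  by (simp add: vec_eq_iff outer_def matrix_matrix_mult_def inner_vec_def sum_distrib_left
      sum_distrib_right mult_ac)

lemma transpose_outer: "transpose (outer u v) = outer v u"
  by (simp add: vec_eq_iff outer_def transpose_def mult.commute)

text \<open>The curve is the rotation by the angle \<open>t\<close> in the plane spanned by \<open>u\<close> and \<open>v\<close>, the identity on
  its orthogonal complement.\<close>

lemma plane_rotation_velocity:
  fixes u v :: "real^'r"
  assumes uv: "norm u = 1" "norm v = 1" "u \<bullet> v = 0"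
  shows "outer u v - outer v u \<in> tangent_space stiefel (mat 1)"
proof -
  interpret bounded_bilinear "(**) :: real^'r^'r \<Rightarrow> real^'r^'r \<Rightarrow> real^'r^'r"
    by (rule bounded_bilinear_matrix_mult)
  define J where "J = outer u v - outer v u"
  \<comment> \<open>the orthogonal projection onto the plane; \<open>J\<close> is the quarter turn in it\<close>
  define P where "P = outer u u + outer v v"
  define Q where "Q t = mat 1 + (cos t - 1) *\<^sub>R P + sin t *\<^sub>R J" for t
  have uv': "u \<bullet> u = 1" "v \<bullet> v = 1" "v \<bullet> u = 0"
    using uv by (auto simp: norm_eq_1 inner_commute)
  have alg: "P ** P = P" "P ** J = J" "J ** P = J" "J ** J = - P"
    unfolding P_def J_def
    by (simp_all add: add_left add_right diff_left diff_right outer_mult uv uv')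
  have tr: "transpose P = P" "transpose J = - J"
    unfolding P_def J_def
    by (simp_all add: linear_add[OF linear_transpose] linear_diff[OF linear_transpose] transpose_outer)
  have tQ: "transpose (Q t) = mat 1 + (cos t - 1) *\<^sub>R P - sin t *\<^sub>R J" for t
    unfolding Q_def
    by (simp add: linear_add[OF linear_transpose] linear_scale[OF linear_transpose] tr transpose_mat)
  have "(mat 1 + a *\<^sub>R P - b *\<^sub>R J) ** (mat 1 + a *\<^sub>R P + b *\<^sub>R J)
      = mat 1 + (a + a + a * a + b * b) *\<^sub>R P" for a b
    by (simp only: add_left add_right diff_left diff_right scaleR_left scaleR_right alg
        matrix_mul_lid matrix_mul_rid) (simp add: vec_eq_iff algebra_simps)
  moreover have "(cos t - 1) + (cos t - 1) + (cos t - 1) * (cos t - 1) + sin t * sin t = 0"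
    for t :: real
    using sin_cos_squared_add[of t] by (simp add: algebra_simps power2_eq_square)
  ultimately have orth: "Q t \<in> stiefel" for t
    unfolding stiefel_def mem_Collect_eq tQ by (simp add: Q_def)
  show ?thesis
    unfolding J_def[symmetric]
  proof (rule tangent_spaceI[of 1 Q _ _ "\<lambda>t. (- sin t) *\<^sub>R P + cos t *\<^sub>R J"])
    show "(Q has_vector_derivative (- sin t) *\<^sub>R P + cos t *\<^sub>R J) (at t)" for t
      unfolding Q_def by (auto intro!: derivative_eq_intros simp: has_real_derivative_iff_has_vector_derivative[symmetric])
    show "continuous_on {- 1<..<1} (\<lambda>t. - sin t *\<^sub>R P + cos t *\<^sub>R J)"
      by (intro continuous_intros)
    show "Q 0 = mat 1"
      by (simp add: Q_def)
  qed (use orth in auto)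
qed

lemma outer_axis: "outer (axis a 1) (axis b 1) $ i $ j = (if a = i \<and> b = j then 1 else 0)"
  by (simp add: outer_def axis_def)

lemma sum_double_delta:
  fixes f :: "'a::finite \<Rightarrow> 'b::finite \<Rightarrow> real"
  shows "(\<Sum>a\<in>UNIV. \<Sum>b\<in>UNIV. f a b * (if a = i \<and> b = j then 1 else 0)) = f i j"
proof -
  have "(\<Sum>b\<in>UNIV. f a b * (if a = i \<and> b = j then 1 else 0)) = (if a = i then f a j else 0)" for a
    by (cases "a = i") (simp_all add: if_distrib cong: if_cong)
  then show ?thesis
    by simp
qed

text \<open>Skew matrices are linear combinations of the generators of the rotations in coordinate planes, and
  the velocities at the identity form a subspace. This produces a curve for every skew matrix
  without a matrix exponential.\<close>

lemma skew_in_tangent_space_orthogonal: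
  fixes W :: "real^'r^'r"
  assumes skew: "transpose W = - W"
  shows "W \<in> tangent_space stiefel (mat 1)"
proof -
  define T where "T = tangent_space (stiefel :: (real^'r^'r) set) (mat 1)"
  have "subspace T"
    unfolding T_def
    by (rule subspace_tangent_space_matrix_group)
      (auto simp: stiefel_def orthogonal_matrix[symmetric] orthogonal_matrix_mul
        orthogonal_matrix_transpose orthogonal_matrix_id)
  have W: "W = (\<Sum>a\<in>UNIV. \<Sum>b\<in>UNIV. (W $ a $ b / 2) *\<^sub>R
      (outer (axis a 1) (axis b 1) - outer (axis b 1) (axis a 1)))" (is "_ = ?S")
  proof -
    have Wt: "W $ j $ i = - W $ i $ j" for i j
      using arg_cong[OF skew, of "\<lambda>A. A $ i $ j"] by (simp add: transpose_def)
    \<comment> \<open>every coordinate plane occurs twice in the double sum, hence the factor one half\<close>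
    have "?S $ i $ j = W $ i $ j" for i j
    proof -
      have "?S $ i $ j
          = (\<Sum>a\<in>UNIV. \<Sum>b\<in>UNIV. W $ a $ b / 2 * (if a = i \<and> b = j then 1 else 0))
            - (\<Sum>a\<in>UNIV. \<Sum>b\<in>UNIV. W $ a $ b / 2 * (if a = j \<and> b = i then 1 else 0))"
        by (simp only: sum_component vector_scaleR_component vector_minus_component outer_axis
            right_diff_distrib sum_subtractf real_scaleR_def conj_commute)
      also have "\<dots> = W $ i $ j / 2 - W $ j $ i / 2"
        by (simp only: sum_double_delta)
      also have "\<dots> = W $ i $ j"
        unfolding Wt[of j i] by simp
      finally show ?thesis .
    qed
    then show ?thesis
      by (intro vec_eq_iff[THEN iffD2] allI) (simp only:)
  qed
  have "outer (axis a 1) (axis b 1) - outer (axis b 1) (axis a 1) \<in> T" for a b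
  proof (cases "a = b")
    case True
    then show ?thesis using subspace_0[OF \<open>subspace T\<close>] by simp
  next
    case False
    then show ?thesis
      unfolding T_def by (intro plane_rotation_velocity) (auto simp: inner_axis_axis)
  qed
  then have "?S \<in> T"
    by (intro subspace_sum subspace_scale \<open>subspace T\<close>)
  then show ?thesis
    using W by (simp add: T_def)
qed

text \<open>The orthogonal group acts on the Stiefel manifold from the left, so a curve through \<open>Y\<close> can be
  taken to be \<open>C Y\<close> for a curve \<open>C\<close> of orthogonal matrices through the identity. Hence it is enough
  to find, for each \<open>V\<close> with \<open>Y\<^sup>T V\<close> skew, a skew matrix \<open>W\<close> with \<open>W Y = V\<close>. The kernel description makes
  the tangent space a subspace.\<close>

lemma tangent_space_stiefel:
  fixes Y :: "real^'d^'r"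
  assumes Y: "Y \<in> stiefel"
  shows "tangent_space stiefel Y = {V. transpose Y ** V + transpose V ** Y = 0}"
proof (intro Set.equalityI subsetI)
  have YY: "transpose Y ** Y = mat 1"
    using Y by (simp add: stiefel_def)
  fix V :: "real^'d^'r"
  {
    assume V: "V \<in> tangent_space stiefel Y"
    from tangent_spaceE[OF V] obtain c D e where c: "e > 0" "\<And>t. \<bar>t\<bar> < e \<Longrightarrow> c t \<in> stiefel"
      "c 0 = Y" "D 0 = V" "\<And>t. \<bar>t\<bar> < e \<Longrightarrow> (c has_vector_derivative D t) (at t)"
      by metis
    have c0: "(c has_vector_derivative V) (at 0)"
      using c(5)[of 0] c by simp
    have "((\<lambda>t. transpose (c t)) has_vector_derivative transpose V) (at 0)"
      using linear_transpose
      by (intro bounded_linear.has_vector_derivative[OF _ c0]) (simp add: linear_conv_bounded_linear)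
    from bounded_bilinear.has_vector_derivative[OF bounded_bilinear_matrix_mult this c0]
    have "((\<lambda>t. transpose (c t) ** c t) has_vector_derivative
        transpose Y ** V + transpose V ** Y) (at 0)"
      by (simp add: c)
    moreover have "((\<lambda>t. transpose (c t) ** c t) has_vector_derivative 0) (at 0)"
      by (rule has_vector_derivative_transform_within_open[of "\<lambda>_. mat 1" _ _ "{-e<..<e}"])
        (use c in \<open>auto simp: stiefel_def\<close>)
    ultimately show "V \<in> {V. transpose Y ** V + transpose V ** Y = 0}"
      by (auto dest: vector_derivative_unique_at)
  next
    assume "V \<in> {V. transpose Y ** V + transpose V ** Y = 0}"
    then have skew: "transpose V ** Y = - (transpose Y ** V)"
      by (simp add: eq_neg_iff_add_eq_0 add.commute)
    note mm = bounded_bilinear_matrix_mult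
    note bil = bounded_bilinear.add_left[OF mm] bounded_bilinear.diff_left[OF mm]
      bounded_bilinear.minus_left[OF mm] bounded_bilinear.minus_right[OF mm]
    note tr = linear_add[OF linear_transpose] linear_diff[OF linear_transpose]
      linear_neg[OF linear_transpose]
    \<comment> \<open>\<open>V Y\<^sup>T\<close> maps \<open>Y\<close> to \<open>V\<close>; making it skew counts the part of \<open>V\<close> in the range of \<open>Y\<close> twice,
      which the last term corrects\<close>
    define W where "W = V ** transpose Y - Y ** transpose V - Y ** (transpose Y ** V) ** transpose Y"
    have "Y ** transpose V ** Y = - (Y ** (transpose Y ** V))"
      by (simp add: matrix_mul_assoc[symmetric] skew bil)
    moreover have "V ** transpose Y ** Y = V"
      "Y ** (transpose Y ** V) ** transpose Y ** Y = Y ** (transpose Y ** V)"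
      by (simp_all add: matrix_mul_assoc[symmetric] YY)
    ultimately have WY: "W ** Y = V"
      unfolding W_def by (simp add: bil)
    have "transpose (Y ** (transpose Y ** V) ** transpose Y)
        = Y ** (transpose V ** Y) ** transpose Y"
      by (simp add: matrix_transpose_mul matrix_mul_assoc)
    also have "\<dots> = - (Y ** (transpose Y ** V) ** transpose Y)"
      by (simp add: skew bil)
    finally have "transpose W = - W"
      unfolding W_def by (simp add: tr matrix_transpose_mul)
    then have "W \<in> tangent_space stiefel (mat 1)"
      by (rule skew_in_tangent_space_orthogonal)
    then have "W ** Y \<in> tangent_space stiefel (mat 1 ** Y)"
    proof (rule tangent_space_linear_image[where h="\<lambda>A. A ** Y", rotated -1])
      show "linear (\<lambda>A. A ** Y)"
        by (intro bounded_linear.linear bounded_bilinear.bounded_linear_left[OF mm])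
      show "A ** Y \<in> stiefel" if "A \<in> stiefel" for A :: "real^'r^'r"
      proof -
        have "transpose (A ** Y) ** (A ** Y) = transpose Y ** (transpose A ** A) ** Y"
          by (simp add: matrix_transpose_mul matrix_mul_assoc)
        then show ?thesis
          using that YY by (simp add: stiefel_def)
      qed
    qed
    then show "V \<in> tangent_space stiefel Y"
      by (simp add: WY)
  }
qed

lemma subspace_tangent_space_stiefel:
  fixes Y :: "real^'d^'r"
  assumes "Y \<in> stiefel"
  shows "subspace (tangent_space stiefel Y)"
proof -
  note mm = bounded_bilinear_matrix_mult
  have lin: "linear (\<lambda>V. transpose Y ** V + transpose V ** Y)"
    by (intro linear_compose_add bounded_linear.linear[OF bounded_bilinear.bounded_linear_right[OF mm]]
        linear_compose[OF linear_transpose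
          bounded_linear.linear[OF bounded_bilinear.bounded_linear_left[OF mm]], unfolded o_def])
  show ?thesis
    using linear_subspace_kernel[OF lin] by (simp add: tangent_space_stiefel[OF assms])
qed

section \<open>Orthogonal projections and gradients\<close>

text \<open>The projection is defined by a definite description, so for a set that is not a subspace it may be
  meaningless. This and the next two lemmas are why all tangent spaces must be shown to be
  subspaces.\<close>

lemma orth_proj_eqI:
  assumes T: "subspace T" and p: "p \<in> T" "\<And>w. w \<in> T \<Longrightarrow> (v - p) \<bullet> w = 0"
  shows "orth_proj T v = p"
  unfolding orth_proj_def
proof (rule the_equality)
  fix q assume q: "q \<in> T \<and> (\<forall>w\<in>T. (v - q) \<bullet> w = 0)"
  have "q - p \<in> T"
    using q p T by (simp add: subspace_diff)
  then have "(q - p) \<bullet> (q - p) = 0"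
    using q p(2)[of "q - p"] by (simp add: inner_diff_left)
  then show "q = p" by simp
qed (use p in auto)

lemma orth_proj:
  assumes T: "subspace T"
  shows "orth_proj T v \<in> T" "w \<in> T \<Longrightarrow> (v - orth_proj T v) \<bullet> w = 0"
proof -
  obtain y z where yz: "y \<in> span T" "\<And>w. w \<in> span T \<Longrightarrow> orthogonal z w" "v = y + z"
    using orthogonal_subspace_decomp_exists[of T v] by blast
  have "span T = T"
    using T by (simp add: span_eq_iff)
  with yz have "orth_proj T v = y"
    by (intro orth_proj_eqI[OF T]) (simp_all add: orthogonal_def)
  then show "orth_proj T v \<in> T" "w \<in> T \<Longrightarrow> (v - orth_proj T v) \<bullet> w = 0"
    using yz \<open>span T = T\<close> by (auto simp: orthogonal_def)
qed

lemma norm_orth_proj_diff_le: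
  assumes T: "subspace T"
  shows "norm (orth_proj T u - orth_proj T v) \<le> norm (u - v)"
proof -
  let ?p = "orth_proj T u - orth_proj T v"
  have pT: "?p \<in> T"
    using T by (simp add: orth_proj subspace_diff)
  have "((u - orth_proj T u) - (v - orth_proj T v)) \<bullet> ?p = 0"
    unfolding inner_diff_left[of "u - orth_proj T u"] using orth_proj(2)[OF T pT] by simp
  then have "?p \<bullet> ?p = (u - v) \<bullet> ?p"
    by (simp add: algebra_simps)
  also have "\<dots> \<le> norm (u - v) * norm ?p"
    by (rule norm_cauchy_schwarz)
  finally have "norm ?p * norm ?p \<le> norm (u - v) * norm ?p"
    by (simp add: dot_square_norm power2_eq_square)
  then show ?thesis
    by (cases "?p = 0") (simp_all add: mult_le_cancel_right)
qed

lemma GDERIV_unique: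
  assumes "GDERIV f x :> D" "GDERIV f x :> D'"
  shows "D = D'"
proof -
  have "(\<lambda>h. h \<bullet> D) = (\<lambda>h. h \<bullet> D')"
    using assms unfolding gderiv_def by (rule has_derivative_unique)
  then show ?thesis
    by (metis inner_commute vector_eq_rdot)
qed

lemma euclidean_grad_eq: "GDERIV f x :> D \<Longrightarrow> euclidean_grad f x = D"
  unfolding euclidean_grad_def by (blast intro: GDERIV_unique)

lemma GDERIV_euclidean_grad:
  assumes "f differentiable (at x)"
  shows "GDERIV f x :> euclidean_grad f x"
proof -
  obtain f' where f': "(f has_derivative f') (at x)"
    using assms by (auto simp: differentiable_def)
  have lin: "linear f'"
    using f' by (intro bounded_linear.linear has_derivative_bounded_linear)
  have "f' h = h \<bullet> (\<Sum>b\<in>Basis. f' b *\<^sub>R b)" for h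
  proof -
    have "f' h = f' (\<Sum>b\<in>Basis. (h \<bullet> b) *\<^sub>R b)"
      by (simp only: euclidean_representation)
    also have "\<dots> = (\<Sum>b\<in>Basis. (h \<bullet> b) * f' b)"
      by (simp only: linear_sum[OF lin] linear_scale[OF lin] real_scaleR_def)
    also have "\<dots> = h \<bullet> (\<Sum>b\<in>Basis. f' b *\<^sub>R b)"
      by (simp only: inner_sum_right inner_scaleR_right mult.commute)
    finally show ?thesis .
  qed
  then have "f' = (\<lambda>h. h \<bullet> (\<Sum>b\<in>Basis. f' b *\<^sub>R b))" ..
  then have "GDERIV f x :> (\<Sum>b\<in>Basis. f' b *\<^sub>R b)"
    using f' unfolding gderiv_def by metis
  then show ?thesis
    by (simp add: euclidean_grad_eq)
qed

section \<open>Blocks and product manifolds\<close>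

lemma block_nth: "block G i x $ v = (if robot_of G v = i then x $ v else 0)"
  by (simp add: block_def)

lemma linear_block: "linear (block G i)"
  by (rule linearI) (simp_all add: vec_eq_iff block_nth)

lemma block_block: "block G i (block G j x) = (if i = j then block G j x else 0)"
  by (auto simp: vec_eq_iff block_nth)

lemma sum_block: "(\<Sum>i\<in>UNIV. block G i x) = x"
  for G :: "('v::finite, 'n::finite, 'd::finite) pose_graph"
  by (simp add: vec_eq_iff block_nth)

lemma inner_block: "block G i x \<bullet> y = x \<bullet> block G i y"
  by (auto simp: inner_vec_def block_nth intro!: sum.cong)

lemma norm_block_le: "norm (block G i x) \<le> norm x"
  by (rule norm_le_componentwise_cart) (simp add: block_nth)

lemma norm_square_blocks: "(norm x)\<^sup>2 = (\<Sum>i\<in>UNIV. (norm (block G i x))\<^sup>2)"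
  for G :: "('v::finite, 'n::finite, 'd::finite) pose_graph"
proof -
  have "(\<Sum>i\<in>UNIV. (norm (block G i x))\<^sup>2) = (\<Sum>i\<in>UNIV. x \<bullet> block G i x)"
    by (simp add: power2_norm_eq_inner inner_block block_block)
  then show ?thesis
    by (simp add: inner_sum_right[symmetric] sum_block power2_norm_eq_inner)
qed

lemma differentiable_norm_linear_square:
  fixes A :: "'a::euclidean_space \<Rightarrow> 'b::euclidean_space"
  assumes "linear A"
  shows "(\<lambda>x. (norm (A x))\<^sup>2) differentiable (at x)"
proof -
  have "(A has_derivative A) (at x)"
    using assms by (simp add: linear_imp_has_derivative)
  from has_derivative_inner[OF this this] show ?thesis
    by (auto simp: power2_norm_eq_inner differentiable_def)
qed

lemma differentiable_cost: "cost G differentiable (at x)"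
  for x :: "('d::finite, 'r::finite, 'v::finite) config"
proof -
  have lin1: "linear (\<lambda>x :: ('d, 'r, 'v) config. fst (x $ v) - fst (x $ u) ** A)"
    and lin2: "linear (\<lambda>x :: ('d, 'r, 'v) config. snd (x $ v) - snd (x $ u) - fst (x $ u) *v b)"
    for u v A b
    by (auto intro!: linearI simp: bounded_bilinear.add_left[OF bounded_bilinear_matrix_mult]
        bounded_bilinear.scaleR_left[OF bounded_bilinear_matrix_mult] algebra_simps
        matrix_vector_mult_add_rdistrib scaleR_matrix_vector_assoc)
  have "edge_cost G u v differentiable (at x)" for u v
    unfolding edge_cost_def
    by (rule differentiable_add; rule differentiable_mult, rule differentiable_const,
        rule differentiable_norm_linear_square, rule lin1 lin2)
  then show ?thesis
    unfolding cost_def case_prod_unfold by (simp add: differentiable_sum)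
qed

text \<open>The common shape of the manifold of one robot and of the joint manifold: poses in \<open>S\<close> are free up
  to the constraint \<open>Q\<close> on their matrix, all other poses are pinned to zero.\<close>

definition pose_product :: "'v set \<Rightarrow> (real^'d^'r) set \<Rightarrow> ('d::finite, 'r::finite, 'v::finite) config set" where
  "pose_product S Q = {z. \<forall>v. if v \<in> S then fst (z $ v) \<in> Q else z $ v = 0}"

lemma robot_manifold_pose_product:
  "robot_manifold G Q i = pose_product {v. robot_of G v = i} Q"
  by (auto simp: robot_manifold_def pose_product_def)

lemma joint_manifold_pose_product: "joint_manifold G Q = pose_product UNIV Q"
  unfolding joint_manifold_def robot_manifold_def pose_product_def
  by (simp add: block_nth cong: if_cong)

text \<open>A curve in the product is a family of curves, one per pose; as there are finitely many poses, the
  domains of these curves have a common interval around zero. The translations are unconstrained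
  and move along straight lines.\<close>

lemma tangent_space_pose_product:
  fixes z :: "('d::finite, 'r::finite, 'v::finite) config"
  assumes z: "z \<in> pose_product S Q"
  shows "tangent_space (pose_product S Q) z
    = {\<eta>. \<forall>v. if v \<in> S then fst (\<eta> $ v) \<in> tangent_space Q (fst (z $ v)) else \<eta> $ v = 0}"
    (is "_ = ?T")
proof (intro Set.equalityI subsetI)
  fix \<eta> assume \<eta>: "\<eta> \<in> tangent_space (pose_product S Q) z"
  have "linear (\<lambda>z :: ('d, 'r, 'v) config. fst (z $ v))" "linear (\<lambda>z :: ('d, 'r, 'v) config. z $ v)" for v
    by (auto intro: linearI)
  note image = this[THEN tangent_space_linear_image, OF _ \<eta>]
  have "fst (\<eta> $ v) \<in> tangent_space Q (fst (z $ v))" if "v \<in> S" for v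
    using that by (intro image) (simp add: pose_product_def split: if_splits)
  moreover have "\<eta> $ v \<in> tangent_space {0} (z $ v)" if "v \<notin> S" for v
    using that by (intro image) (simp add: pose_product_def split: if_splits)
  moreover have "tangent_space {0} y = {0}" if "y = 0" for y :: "(real^'d^'r) \<times> (real^'r)"
  proof -
    have "w = 0" if w: "w \<in> tangent_space {0} y" for w
    proof -
      obtain c D e where c: "e > 0" "\<And>t. \<bar>t\<bar> < e \<Longrightarrow> c t \<in> {0}" "D 0 = w"
        "\<And>t. \<bar>t\<bar> < e \<Longrightarrow> (c has_vector_derivative D t) (at t)"
        using tangent_spaceE[OF w] by metis
      have "(c has_vector_derivative 0) (at 0)"
        by (rule has_vector_derivative_transform_within_open[of "\<lambda>_. 0" _ _ "{-e<..<e}"])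
          (use c in auto)
      with c(4)[of 0] c(1,3) show ?thesis
        by (auto dest: vector_derivative_unique_at)
    qed
    then show ?thesis
      using \<open>y = 0\<close> tangent_space_zero[of y "{0}"] by auto
  qed
  ultimately show "\<eta> \<in> ?T"
    using z by (auto simp: pose_product_def)
next
  fix \<eta> :: "('d, 'r, 'v) config" assume \<eta>: "\<eta> \<in> ?T"
  define curve where "curve v e c D \<longleftrightarrow>
      e > 0 \<and> (\<forall>t. \<bar>t\<bar> < e \<longrightarrow> c t \<in> Q) \<and> c 0 = fst (z $ v) \<and> D 0 = fst (\<eta> $ v) \<and>
      (\<forall>t. \<bar>t\<bar> < e \<longrightarrow> (c has_vector_derivative D t) (at t)) \<and> continuous_on {-e<..<e} D"
    for v e c D
  have "\<exists>e c D. curve v e c D" if "v \<in> S" for v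
  proof -
    have "fst (\<eta> $ v) \<in> tangent_space Q (fst (z $ v))"
      using \<eta> that by (metis (lifting) mem_Collect_eq)
    then show ?thesis
      unfolding curve_def by (rule tangent_spaceE) blast
  qed
  then obtain e c D where "\<And>v. v \<in> S \<Longrightarrow> curve v (e v) (c v) (D v)"
    by metis
  then have c: "\<And>v. v \<in> S \<Longrightarrow> e v > 0"
      "\<And>v t. v \<in> S \<Longrightarrow> \<bar>t\<bar> < e v \<Longrightarrow> c v t \<in> Q"
      "\<And>v. v \<in> S \<Longrightarrow> c v 0 = fst (z $ v)" "\<And>v. v \<in> S \<Longrightarrow> D v 0 = fst (\<eta> $ v)"
      "\<And>v t. v \<in> S \<Longrightarrow> \<bar>t\<bar> < e v \<Longrightarrow> (c v has_vector_derivative D v t) (at t)"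
      "\<And>v. v \<in> S \<Longrightarrow> continuous_on {-e v<..<e v} (D v)"
    unfolding curve_def by blast+
  \<comment> \<open>the \<open>1\<close> keeps the minimum defined when \<open>S\<close> is empty\<close>
  define \<epsilon> where "\<epsilon> = Min (insert 1 (e ` S))"
  have \<epsilon>: "\<epsilon> > 0" "\<And>v. v \<in> S \<Longrightarrow> \<epsilon> \<le> e v"
    unfolding \<epsilon>_def using c(1) by (auto simp: Min_gr_iff)
  have lin: "bounded_linear (axis v :: _ \<Rightarrow> ('d, 'r, 'v) config)" for v
    unfolding linear_conv_bounded_linear[symmetric]
    by (rule linearI) (auto simp: vec_eq_iff axis_def)
  have vec: "(\<Sum>v\<in>S. axis v (g v)) = (\<chi> w. if w \<in> S then g w else 0)"
    for g :: "'v \<Rightarrow> (real^'d^'r) \<times> (real^'r)"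
    by (simp add: vec_eq_iff axis_def)
  let ?c = "\<lambda>t. \<Sum>v\<in>S. axis v (c v t, snd (z $ v) + t *\<^sub>R snd (\<eta> $ v))"
  let ?D = "\<lambda>t. \<Sum>v\<in>S. axis v (D v t, snd (\<eta> $ v))"
  show "\<eta> \<in> tangent_space (pose_product S Q) z"
  proof (rule tangent_spaceI[of \<epsilon> ?c _ _ ?D])
    show "?c t \<in> pose_product S Q" if "\<bar>t\<bar> < \<epsilon>" for t
    proof -
      have "c v t \<in> Q" if "v \<in> S" for v
        using c(2)[OF that] \<epsilon>(2)[OF that] \<open>\<bar>t\<bar> < \<epsilon>\<close> by simp
      then show ?thesis
        unfolding vec by (simp add: pose_product_def)
    qed
    show "?c 0 = z"
      unfolding vec using z by (auto simp: vec_eq_iff c(3) pose_product_def)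
    show "?D 0 = \<eta>"
      unfolding vec using \<eta> by (auto simp: vec_eq_iff c(4))
    show "(?c has_vector_derivative ?D t) (at t)" if "\<bar>t\<bar> < \<epsilon>" for t
    proof (rule has_vector_derivative_sum, rule bounded_linear.has_vector_derivative[OF lin])
      fix v assume v: "v \<in> S"
      have "((\<lambda>t. snd (z $ v) + t *\<^sub>R snd (\<eta> $ v)) has_vector_derivative snd (\<eta> $ v)) (at t)"
        by (auto intro!: derivative_eq_intros)
      then show "((\<lambda>t. (c v t, snd (z $ v) + t *\<^sub>R snd (\<eta> $ v))) has_vector_derivative
          (D v t, snd (\<eta> $ v))) (at t)"
        using c(5)[OF v] \<epsilon>(2)[OF v] that by (intro has_vector_derivative_Pair) auto
    qed
    show "continuous_on {-\<epsilon><..<\<epsilon>} ?D"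
    proof (intro continuous_on_sum bounded_linear.continuous_on[OF lin] continuous_on_Pair
        continuous_on_const)
      show "continuous_on {-\<epsilon><..<\<epsilon>} (D v)" if "v \<in> S" for v
        using \<epsilon>(2)[OF that] by (intro continuous_on_subset[OF c(6)[OF that]]) auto
    qed
  qed (fact \<epsilon>)
qed

lemma subspace_tangent_space_pose_product:
  assumes Q: "\<And>Y. Y \<in> Q \<Longrightarrow> subspace (tangent_space Q Y)" and z: "z \<in> pose_product S Q"
  shows "subspace (tangent_space (pose_product S Q) z)"
proof -
  have sub: "subspace (tangent_space Q (fst (z $ v)))" if "v \<in> S" for v
    using z that by (intro Q) (auto simp: pose_product_def split: if_splits)
  show ?thesis
    unfolding tangent_space_pose_product[OF z]
    by (rule subspaceI) (auto simp: subspace_0[OF sub] subspace_add[OF sub] subspace_scale[OF sub])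
qed

lemma block_in_robot_manifold: "x \<in> joint_manifold G Q \<Longrightarrow> block G i x \<in> robot_manifold G Q i"
  by (simp add: joint_manifold_def)

lemma tangent_space_robot_manifold:
  fixes x \<eta> :: "('d::finite, 'r::finite, 'v::finite) config"
  assumes Q: "\<And>Y. Y \<in> Q \<Longrightarrow> subspace (tangent_space Q Y)" and x: "x \<in> joint_manifold G Q"
  shows "tangent_space (robot_manifold G Q i) (block G i x)
    = {\<eta> \<in> tangent_space (joint_manifold G Q) x. block G i \<eta> = \<eta>}"
    and "\<eta> \<in> tangent_space (joint_manifold G Q) x
      \<Longrightarrow> block G i \<eta> \<in> tangent_space (robot_manifold G Q i) (block G i x)"
proof -
  have xQ: "fst (x $ v) \<in> Q" for v
    using x by (auto simp: joint_manifold_pose_product pose_product_def)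
  have joint: "tangent_space (joint_manifold G Q) x
      = {\<eta>. \<forall>v. fst (\<eta> $ v) \<in> tangent_space Q (fst (x $ v))}"
    using x unfolding joint_manifold_pose_product by (simp add: tangent_space_pose_product)
  have robot: "tangent_space (robot_manifold G Q i) (block G i x)
      = {\<eta>. \<forall>v. if robot_of G v = i then fst (\<eta> $ v) \<in> tangent_space Q (fst (x $ v)) else \<eta> $ v = 0}"
    using block_in_robot_manifold[OF x] unfolding robot_manifold_pose_product
    by (auto simp: tangent_space_pose_product block_nth)
  show "tangent_space (robot_manifold G Q i) (block G i x)
    = {\<eta> \<in> tangent_space (joint_manifold G Q) x. block G i \<eta> = \<eta>}"
    unfolding joint robot
  proof (intro Set.equalityI subsetI)
    fix \<eta> :: "('d, 'r, 'v) config"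
    assume \<eta>: "\<eta> \<in> {\<eta>. \<forall>v. if robot_of G v = i
        then fst (\<eta> $ v) \<in> tangent_space Q (fst (x $ v)) else \<eta> $ v = 0}"
    have "fst (\<eta> $ v) \<in> tangent_space Q (fst (x $ v))" "block G i \<eta> $ v = \<eta> $ v" for v
      using \<eta> subspace_0[OF Q[OF xQ[of v]]]
      by (cases "robot_of G v = i"; force simp: block_nth split: if_splits)+
    then show "\<eta> \<in> {\<eta> \<in> {\<eta>. \<forall>v. fst (\<eta> $ v) \<in> tangent_space Q (fst (x $ v))}. block G i \<eta> = \<eta>}"
      by (simp add: vec_eq_iff)
  next
    fix \<eta> :: "('d, 'r, 'v) config"
    assume "\<eta> \<in> {\<eta> \<in> {\<eta>. \<forall>v. fst (\<eta> $ v) \<in> tangent_space Q (fst (x $ v))}. block G i \<eta> = \<eta>}"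
    moreover from this have "\<eta> $ v = (if robot_of G v = i then \<eta> $ v else 0)" for v
      by (metis (mono_tags, lifting) block_nth mem_Collect_eq)
    ultimately show "\<eta> \<in> {\<eta>. \<forall>v. if robot_of G v = i
        then fst (\<eta> $ v) \<in> tangent_space Q (fst (x $ v)) else \<eta> $ v = 0}"
      by (simp split: if_splits) metis
  qed
  show "\<eta> \<in> tangent_space (joint_manifold G Q) x
      \<Longrightarrow> block G i \<eta> \<in> tangent_space (robot_manifold G Q i) (block G i x)"
    unfolding joint robot by (auto simp: block_nth)
qed

text \<open>Since the tangent space of the product is the product of the tangent spaces, the Riemannian gradient
  can be taken blockwise.\<close>

lemma block_orth_proj:
  assumes Q: "\<And>Y. Y \<in> Q \<Longrightarrow> subspace (tangent_space Q Y)" and x: "x \<in> joint_manifold G Q"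
  shows "block G i (orth_proj (tangent_space (joint_manifold G Q) x) g)
    = orth_proj (tangent_space (robot_manifold G Q i) (block G i x)) (block G i g)"
proof -
  let ?T = "tangent_space (joint_manifold G Q) x"
  let ?Ti = "tangent_space (robot_manifold G Q i) (block G i x)"
  have T: "subspace ?T" "subspace ?Ti"
    using x block_in_robot_manifold[OF x]
    by (auto intro!: subspace_tangent_space_pose_product Q
        simp: joint_manifold_pose_product robot_manifold_pose_product)
  have "block G i (orth_proj ?T g) \<in> ?Ti"
    by (intro tangent_space_robot_manifold(2) Q x orth_proj T)
  moreover have "(block G i g - block G i (orth_proj ?T g)) \<bullet> w = 0" if "w \<in> ?Ti" for w
  proof -
    have w: "w \<in> ?T" "block G i w = w"
      using that by (auto simp: tangent_space_robot_manifold(1)[OF Q x])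
    have "(block G i g - block G i (orth_proj ?T g)) \<bullet> w = (g - orth_proj ?T g) \<bullet> block G i w"
      by (simp add: linear_diff[OF linear_block, symmetric] inner_block)
    then show ?thesis
      using orth_proj(2)[OF T(1) w(1)] w by simp
  qed
  ultimately show ?thesis
    by (rule orth_proj_eqI[OF T(2), symmetric])
qed

section \<open>Descent along one asynchronous step\<close>

text \<open>The joint configuration that robot \<open>i\<close> believes in: its own variable is \<open>y\<close>, the variable of any
  other robot \<open>j\<close> is taken from the copy \<open>z j\<close>.\<close>

definition splice ::
  "('v, 'n, 'd::finite) pose_graph \<Rightarrow> 'n \<Rightarrow> ('d::finite, 'r::finite, 'v::finite) config \<Rightarrow>
   ('n \<Rightarrow> ('d, 'r, 'v) config) \<Rightarrow> ('d, 'r, 'v) config" where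
  "splice G i y z = (\<chi> v. if robot_of G v = i then y $ v else z (robot_of G v) $ v)"

lemma edge_cost_cong:
  "x $ u = y $ u \<Longrightarrow> x $ v = y $ v \<Longrightarrow> edge_cost G u v x = edge_cost G u v y"
  by (simp add: edge_cost_def)

text \<open>The remainder collects the measurements that do not involve robot \<open>i\<close> and is written with \<open>0\<close> in
  place of \<open>y\<close> to display that it does not depend on \<open>y\<close>. Edges between two robots are collected
  regardless of direction, so the sum over the neighbours meets each measurement of robot \<open>i\<close> once.\<close>

lemma cost_splice:
  fixes G :: "('v::finite, 'n::finite, 'd::finite) pose_graph"
  shows "cost G (splice G i y z) = local_cost G i z y
    + (\<Sum>(u, v)\<in>{(u, v)\<in>edges G. robot_of G u \<noteq> i \<and> robot_of G v \<noteq> i}.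
        edge_cost G u v (splice G i 0 z))"
    (is "_ = _ + sum _ ?R")
proof -
  let ?f = "\<lambda>(u, v). edge_cost G u v (splice G i y z)"
  have fin: "finite A" for A :: "('v \<times> 'v) set"
    by (rule finite)
  have E: "edges G = ?R \<union> (edges_between G i i \<union> (\<Union>j\<in>neighbors G i. edges_between G i j))"
    by (auto simp: edges_between_def neighbors_def doubleton_eq_iff)
  have "cost G (splice G i y z)
      = sum ?f ?R + sum ?f (edges_between G i i \<union> (\<Union>j\<in>neighbors G i. edges_between G i j))"
    unfolding cost_def
    by (subst E, rule sum.union_disjoint) (auto simp: edges_between_def doubleton_eq_iff)
  also have "sum ?f (edges_between G i i \<union> (\<Union>j\<in>neighbors G i. edges_between G i j))
      = sum ?f (edges_between G i i) + sum ?f (\<Union>j\<in>neighbors G i. edges_between G i j)"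
    by (rule sum.union_disjoint) (auto simp: edges_between_def neighbors_def doubleton_eq_iff)
  also have "sum ?f (\<Union>j\<in>neighbors G i. edges_between G i j)
      = (\<Sum>j\<in>neighbors G i. sum ?f (edges_between G i j))"
    by (rule sum.UNION_disjoint) (auto simp: edges_between_def neighbors_def doubleton_eq_iff)
  also have "sum ?f (edges_between G i i) = intra_cost G i y"
    unfolding intra_cost_def
    by (intro sum.cong refl) (auto simp: edges_between_def splice_def block_nth intro!: edge_cost_cong)
  also have "(\<Sum>j\<in>neighbors G i. sum ?f (edges_between G i j))
      = (\<Sum>j\<in>neighbors G i. inter_cost G i j y (z j))"
    unfolding inter_cost_def
    by (intro sum.cong refl) (auto simp: edges_between_def splice_def block_nth neighbors_def
        doubleton_eq_iff intro!: edge_cost_cong)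
  also have "sum ?f ?R = (\<Sum>(u, v)\<in>?R. edge_cost G u v (splice G i 0 z))"
    by (intro sum.cong refl) (auto simp: splice_def intro!: edge_cost_cong)
  finally show ?thesis
    by (simp add: local_cost_def)
qed

text \<open>By the decomposition above, the local cost and the joint cost at the spliced configuration differ by
  a constant. So the gradient used by robot \<open>i\<close> is a block of the joint gradient, evaluated at a
  configuration that contains outdated neighbours, and the Lipschitz constant of the joint gradient
  controls the error.\<close>

lemma euclidean_grad_local_cost:
  fixes G :: "('v::finite, 'n::finite, 'd::finite) pose_graph"
  shows "euclidean_grad (local_cost G i z) y = block G i (euclidean_grad (cost G) (splice G i y z))"
proof (rule euclidean_grad_eq)
  have splice: "(\<lambda>y. splice G i y z) = (\<lambda>y. block G i y + splice G i 0 z)"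
    by (simp add: fun_eq_iff vec_eq_iff splice_def block_nth)
  let ?g = "euclidean_grad (cost G) (splice G i y z)"
  have "(block G i has_derivative block G i) (at y)"
    by (rule linear_imp_has_derivative[OF linear_block])
  then have "((\<lambda>y. splice G i y z) has_derivative block G i) (at y)"
    unfolding splice by (rule has_derivative_add_const)
  moreover have "(cost G has_derivative (\<lambda>h. h \<bullet> ?g)) (at (splice G i y z))"
    using GDERIV_euclidean_grad[OF differentiable_cost] by (simp add: gderiv_def)
  ultimately have "((\<lambda>y. cost G (splice G i y z)) has_derivative (\<lambda>h. block G i h \<bullet> ?g)) (at y)"
    by (rule has_derivative_compose)
  then have "((\<lambda>y. cost G (splice G i y z) - c) has_derivative (\<lambda>h. block G i h \<bullet> ?g - 0)) (at y)" for c
    by (rule has_derivative_diff[OF _ has_derivative_const])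
  then have "((\<lambda>y. cost G (splice G i y z) - c) has_derivative (\<lambda>h. h \<bullet> block G i ?g)) (at y)" for c
    by (simp only: diff_zero inner_block)
  moreover have "\<exists>c. local_cost G i z = (\<lambda>y. cost G (splice G i y z) - c)"
    unfolding cost_splice by (rule exI, rule ext, rule add_diff_cancel_right'[symmetric])
  ultimately show "GDERIV (local_cost G i z) y :> block G i ?g"
    unfolding gderiv_def by metis
qed

lemma local_cost_cong:
  "(\<And>j. j \<in> neighbors G i \<Longrightarrow> z j = z' j) \<Longrightarrow> local_cost G i z = local_cost G i z'"
  by (simp add: local_cost_def fun_eq_iff cong: sum.cong)

text \<open>Both gradients are projections of Euclidean gradients onto the same subspace, and projections do not
  increase distances. The copies of robots that are not neighbours do not enter the local cost, so
  they may be replaced by the current values; then the two configurations differ only in the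
  neighbours of \<open>i\<close>, which gives the sum over neighbours alone.\<close>

lemma local_riemannian_grad_error:
  fixes G :: "('v::finite, 'n::finite, 'd::finite) pose_graph"
    and x :: "('d, 'r::finite, 'v) config"
  assumes Q: "\<And>Y. Y \<in> Q \<Longrightarrow> subspace (tangent_space Q Y)" and x: "x \<in> joint_manifold G Q"
    and lip: "L-lipschitz_on UNIV (euclidean_grad (cost G :: ('d, 'r, 'v) config \<Rightarrow> real))"
  shows "(norm (riemannian_grad (robot_manifold G Q i) (local_cost G i z) (block G i x)
      - block G i (riemannian_grad (joint_manifold G Q) (cost G) x)))\<^sup>2
    \<le> L\<^sup>2 * (\<Sum>j\<in>neighbors G i. (norm (block G j (z j - x)))\<^sup>2)"
proof -
  define z' where "z' j = (if j \<in> neighbors G i then z j else x)" for j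
  define X where "X = splice G i (block G i x) z'"
  let ?D = "euclidean_grad (cost G)" and ?Ti = "tangent_space (robot_manifold G Q i) (block G i x)"
  have "local_cost G i z = local_cost G i z'"
    by (rule local_cost_cong) (simp add: z'_def)
  then have "riemannian_grad (robot_manifold G Q i) (local_cost G i z) (block G i x)
      = orth_proj ?Ti (block G i (?D X))"
    by (simp add: riemannian_grad_def euclidean_grad_local_cost X_def)
  moreover have "block G i (riemannian_grad (joint_manifold G Q) (cost G) x)
      = orth_proj ?Ti (block G i (?D x))"
    by (simp add: riemannian_grad_def block_orth_proj[OF Q x])
  moreover have "subspace ?Ti"
    using block_in_robot_manifold[OF x] unfolding robot_manifold_pose_product
    by (rule subspace_tangent_space_pose_product[rotated]) (rule Q)
  ultimately have "norm (riemannian_grad (robot_manifold G Q i) (local_cost G i z) (block G i x)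
      - block G i (riemannian_grad (joint_manifold G Q) (cost G) x))
      \<le> norm (block G i (?D X - ?D x))" (is "?e \<le> _")
    by (simp add: norm_orth_proj_diff_le linear_diff[OF linear_block])
  also have "\<dots> \<le> norm (?D X - ?D x)"
    by (rule norm_block_le)
  also have "\<dots> \<le> L * norm (X - x)"
    using lipschitz_onD[OF lip, of X x] by (simp add: dist_norm)
  finally have "?e\<^sup>2 \<le> (L * norm (X - x))\<^sup>2"
    by (intro power_mono) auto
  also have "\<dots> = L\<^sup>2 * (\<Sum>j\<in>UNIV. (norm (block G j (X - x)))\<^sup>2)"
    by (simp only: power_mult_distrib norm_square_blocks[of "X - x" G])
  also have "(\<Sum>j\<in>UNIV. (norm (block G j (X - x)))\<^sup>2)
      = (\<Sum>j\<in>neighbors G i. (norm (block G j (z j - x)))\<^sup>2)"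
  proof (rule sum.mono_neutral_cong_right)
    show "\<forall>j\<in>UNIV - neighbors G i. (norm (block G j (X - x)))\<^sup>2 = 0"
      by (auto simp: X_def z'_def splice_def vec_eq_iff block_nth)
    show "(norm (block G j (X - x)))\<^sup>2 = (norm (block G j (z j - x)))\<^sup>2"
      if "j \<in> neighbors G i" for j
      using that
      by (intro arg_cong[of _ _ "\<lambda>v. (norm v)\<^sup>2"])
        (auto simp: X_def z'_def splice_def vec_eq_iff block_nth neighbors_def)
  qed auto
  finally show ?thesis .
qed

text \<open>A step that moves a single robot is a step of the product retraction, because a retraction fixes the
  base point along the zero vector. This is what makes the descent inequality on the joint manifold
  applicable.\<close>

lemma block_step_product_retr:
  fixes G :: "('v::finite, 'n::finite, 'd::finite) pose_graph"
  assumes R0: "\<And>j. Retr j (block G j x) 0 = block G j x"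
    and \<eta>: "block G i \<eta> = \<eta>"
    and xi: "block G i x' = Retr i (block G i x) \<eta>"
    and xj: "\<And>j. j \<noteq> i \<Longrightarrow> block G j x' = block G j x"
  shows "product_retr G Retr x \<eta> = x'"
proof -
  have "Retr j (block G j x) (block G j \<eta>) = block G j x'" for j
  proof (cases "j = i")
    case False
    then have "block G j \<eta> = 0"
      using block_block[of G j i \<eta>] \<eta> by simp
    then show ?thesis
      using False R0 xj by simp
  qed (use \<eta> xi in simp)
  then show ?thesis
    by (simp add: product_retr_def sum_block)
qed

text \<open>The descent inequality is applied to the step \<open>- \<gamma> \<eta>\<close>, and the inner product of \<open>\<eta>\<close> with the true
  gradient is expanded by polarization. This leaves a decrease by the squared true gradient, a
  decrease by \<open>\<gamma> (1 - L \<gamma>) / 2\<close> times the squared length of \<open>\<eta>\<close>, and the gradient error. The length of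
  \<open>\<eta>\<close> is then exchanged for the actual displacement \<open>x' - x\<close>, which is at most \<open>\<alpha> \<gamma>\<close> times as long. The
  displacement is the right quantity for taking expectations: it is a function of two iterates,
  whereas \<open>\<eta>\<close> depends on the delays and thus possibly on future choices of robots.\<close>

lemma asynchronous_block_step:
  fixes G :: "('v::finite, 'n::finite, 'd::finite) pose_graph"
    and x x' :: "('d, 'r::finite, 'v) config"
    and Retr :: "'n \<Rightarrow> ('d, 'r, 'v) config \<Rightarrow> ('d, 'r, 'v) config \<Rightarrow> ('d, 'r, 'v) config"
  assumes Q: "\<And>Y. Y \<in> Q \<Longrightarrow> subspace (tangent_space Q Y)" and x: "x \<in> joint_manifold G Q"
    and retr: "\<And>i. manifold_retraction (robot_manifold G Q i) (Retr i)"
    and L: "descent_constant G Q Retr L" and \<alpha>: "retr_bound G Q Retr \<alpha>"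
    and \<gamma>: "0 < \<gamma>" "L * \<gamma> \<le> 1" and \<alpha>_pos: "\<alpha> > 0"
    and \<eta>: "\<eta> = riemannian_grad (robot_manifold G Q i) (local_cost G i z) (block G i x)"
    and xi: "block G i x' = Retr i (block G i x) (- \<gamma> *\<^sub>R \<eta>)"
    and xj: "\<And>j. j \<noteq> i \<Longrightarrow> block G j x' = block G j x"
  shows "x' \<in> joint_manifold G Q"
    and "cost G x' \<le> cost G x
      - \<gamma> / 2 * (norm (block G i (riemannian_grad (joint_manifold G Q) (cost G) x)))\<^sup>2
      - (1 - L * \<gamma>) / (2 * \<gamma> * \<alpha>\<^sup>2) * (norm (x' - x))\<^sup>2
      + \<gamma> / 2 * L\<^sup>2 * (\<Sum>j\<in>neighbors G i. (norm (block G j (z j - x)))\<^sup>2)"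
proof -
  let ?Ti = "tangent_space (robot_manifold G Q i) (block G i x)"
  let ?T = "tangent_space (joint_manifold G Q) x"
  let ?grad = "riemannian_grad (joint_manifold G Q) (cost G) x"
  obtain C where C: "C > 0" "C \<le> L"
    "C-lipschitz_on UNIV (euclidean_grad (cost G :: ('d, 'r, 'v) config \<Rightarrow> real))"
    using L unfolding descent_constant_def by blast
  have lip: "L-lipschitz_on UNIV (euclidean_grad (cost G :: ('d, 'r, 'v) config \<Rightarrow> real))"
    using C by (meson lipschitz_on_le)
  have Mi: "block G j x \<in> robot_manifold G Q j" for j
    by (rule block_in_robot_manifold[OF x])
  have sub: "subspace ?Ti"
    using Mi[of i] unfolding robot_manifold_pose_product
    by (rule subspace_tangent_space_pose_product[rotated]) (rule Q)
  have Ti: "?Ti = {\<eta> \<in> ?T. block G i \<eta> = \<eta>}"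
    by (rule tangent_space_robot_manifold(1)[OF Q x])
  have \<eta>T: "\<eta> \<in> ?Ti"
    unfolding \<eta> riemannian_grad_def by (rule orth_proj[OF sub])
  then have step: "- \<gamma> *\<^sub>R \<eta> \<in> ?Ti"
    by (rule subspace_scale[OF sub])
  then have stepT: "- \<gamma> *\<^sub>R \<eta> \<in> ?T"
    unfolding Ti by blast
  have \<eta>i: "block G i \<eta> = \<eta>"
    using \<eta>T unfolding Ti by blast
  then have stepi: "block G i (- \<gamma> *\<^sub>R \<eta>) = - \<gamma> *\<^sub>R \<eta>"
    by (simp only: linear_scale[OF linear_block])
  have "Retr i (block G i x) (- \<gamma> *\<^sub>R \<eta>) \<in> robot_manifold G Q i"
    using retr Mi step unfolding manifold_retraction_def by blast
  then have "block G j x' \<in> robot_manifold G Q j" for j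
    by (cases "j = i") (use xi xj Mi in auto)
  then show "x' \<in> joint_manifold G Q"
    by (simp add: joint_manifold_def)
  have "product_retr G Retr x (- \<gamma> *\<^sub>R \<eta>) = x'"
  proof (rule block_step_product_retr[where i = i])
    show "Retr j (block G j x) 0 = block G j x" for j
      using retr Mi unfolding manifold_retraction_def by blast
  qed (fact stepi, fact xi, erule xj)
  with L x stepT have "\<bar>cost G x' - cost G x - (- \<gamma> *\<^sub>R \<eta>) \<bullet> ?grad\<bar> \<le> L / 2 * (norm (- \<gamma> *\<^sub>R \<eta>))\<^sup>2"
    unfolding descent_constant_def by metis
  then have "cost G x' - cost G x - (- \<gamma> *\<^sub>R \<eta>) \<bullet> ?grad \<le> L / 2 * (norm (- \<gamma> *\<^sub>R \<eta>))\<^sup>2"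
    by (rule abs_le_D1)
  then have descent: "cost G x' \<le> cost G x - \<gamma> * (\<eta> \<bullet> ?grad) + L / 2 * \<gamma>\<^sup>2 * (norm \<eta>)\<^sup>2"
    by (simp add: power_mult_distrib)
  have "\<eta> \<bullet> ?grad = \<eta> \<bullet> block G i ?grad"
    using inner_block[of G i \<eta> ?grad] \<eta>i by simp
  then have polar: "2 * (\<eta> \<bullet> ?grad) = (norm \<eta>)\<^sup>2 + (norm (block G i ?grad))\<^sup>2
      - (norm (\<eta> - block G i ?grad))\<^sup>2"
    by (simp add: power2_norm_eq_inner inner_diff_left inner_diff_right inner_commute)
  have err: "(norm (\<eta> - block G i ?grad))\<^sup>2
      \<le> L\<^sup>2 * (\<Sum>j\<in>neighbors G i. (norm (block G j (z j - x)))\<^sup>2)"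
    unfolding \<eta> by (rule local_riemannian_grad_error[OF Q x lip])
  have "x' - x = (\<Sum>j\<in>UNIV. block G j (x' - x))"
    by (simp add: sum_block)
  also have "\<dots> = (\<Sum>j\<in>UNIV. if j = i then block G i (x' - x) else 0)"
    by (intro sum.cong refl) (auto simp: linear_diff[OF linear_block] xj)
  also have "\<dots> = Retr i (block G i x) (- \<gamma> *\<^sub>R \<eta>) - block G i x"
    by (simp add: linear_diff[OF linear_block] xi)
  finally have "norm (x' - x) \<le> \<alpha> * norm (- \<gamma> *\<^sub>R \<eta>)"
    using \<alpha> Mi step unfolding retr_bound_def by metis
  then have "(norm (x' - x))\<^sup>2 \<le> (\<alpha> * (\<gamma> * norm \<eta>))\<^sup>2"
    using \<gamma> by (intro power_mono) auto
  then have "(1 - L * \<gamma>) / (2 * \<gamma> * \<alpha>\<^sup>2) * (norm (x' - x))\<^sup>2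
      \<le> (1 - L * \<gamma>) / (2 * \<gamma> * \<alpha>\<^sup>2) * (\<alpha> * (\<gamma> * norm \<eta>))\<^sup>2"
    using \<gamma> by (intro mult_left_mono) auto
  also have "\<dots> = \<gamma> / 2 * (1 - L * \<gamma>) * (norm \<eta>)\<^sup>2"
    using \<gamma> \<alpha>_pos by (simp add: field_simps power2_eq_square)
  finally have len: "(1 - L * \<gamma>) / (2 * \<gamma> * \<alpha>\<^sup>2) * (norm (x' - x))\<^sup>2
      \<le> \<gamma> / 2 * (norm \<eta>)\<^sup>2 - L / 2 * \<gamma>\<^sup>2 * (norm \<eta>)\<^sup>2"
    by (simp add: algebra_simps power2_eq_square)
  have "\<gamma> * (\<eta> \<bullet> ?grad) = \<gamma> / 2 * (norm \<eta>)\<^sup>2 + \<gamma> / 2 * (norm (block G i ?grad))\<^sup>2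
      - \<gamma> / 2 * (norm (\<eta> - block G i ?grad))\<^sup>2"
    using arg_cong[OF polar, of "\<lambda>t. \<gamma> / 2 * t"] by (simp add: algebra_simps)
  moreover have "\<gamma> / 2 * (norm (\<eta> - block G i ?grad))\<^sup>2
      \<le> \<gamma> / 2 * L\<^sup>2 * (\<Sum>j\<in>neighbors G i. (norm (block G j (z j - x)))\<^sup>2)"
    using mult_left_mono[OF err, of "\<gamma> / 2"] \<gamma> by (simp add: mult.assoc)
  ultimately show "cost G x' \<le> cost G x
      - \<gamma> / 2 * (norm (block G i ?grad))\<^sup>2
      - (1 - L * \<gamma>) / (2 * \<gamma> * \<alpha>\<^sup>2) * (norm (x' - x))\<^sup>2
      + \<gamma> / 2 * L\<^sup>2 * (\<Sum>j\<in>neighbors G i. (norm (block G j (z j - x)))\<^sup>2)"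
    using descent len by linarith
qed

section \<open>Expectations over the random choice of robots\<close>

text \<open>Measurability with respect to the first \<open>k\<close> indices, stated pointwise. As the indices have finitely
  many values, a function of this kind is a finite combination of indicators of cylinders, so
  measurability and integrability come for free.\<close>

definition determined_by :: "'w set \<Rightarrow> (nat \<Rightarrow> 'w \<Rightarrow> 'n) \<Rightarrow> nat \<Rightarrow> ('w \<Rightarrow> 'a) \<Rightarrow> bool" where
  "determined_by \<Omega> idx k F \<longleftrightarrow>
     (\<forall>w\<in>\<Omega>. \<forall>w'\<in>\<Omega>. (\<forall>l<k. idx l w = idx l w') \<longrightarrow> F w = F w')"

lemma determined_byD:
  "determined_by \<Omega> idx k F \<Longrightarrow> w \<in> \<Omega> \<Longrightarrow> w' \<in> \<Omega> \<Longrightarrow> (\<And>l. l < k \<Longrightarrow> idx l w = idx l w') \<Longrightarrow> F w = F w'"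
  unfolding determined_by_def by blast

lemma determined_byI:
  "(\<And>w w'. w \<in> \<Omega> \<Longrightarrow> w' \<in> \<Omega> \<Longrightarrow> (\<And>l. l < k \<Longrightarrow> idx l w = idx l w') \<Longrightarrow> F w = F w')
    \<Longrightarrow> determined_by \<Omega> idx k F"
  unfolding determined_by_def by blast

lemma determined_by_mono:
  assumes "determined_by \<Omega> idx k F" "k \<le> m"
  shows "determined_by \<Omega> idx m F"
  by (rule determined_byI, rule determined_byD[OF assms(1)]) (use assms(2) in auto)

lemma determined_by_comp:
  "determined_by \<Omega> idx k F \<Longrightarrow> determined_by \<Omega> idx k (\<lambda>w. \<phi> (F w))"
  by (rule determined_byI, rule arg_cong[of _ _ \<phi>]) (rule determined_byD)

lemma determined_by_comp2:
  assumes "determined_by \<Omega> idx k F" "determined_by \<Omega> idx k H"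
  shows "determined_by \<Omega> idx k (\<lambda>w. \<phi> (F w) (H w))"
  by (rule determined_byI, rule arg_cong2[of _ _ _ _ \<phi>])
    (blast intro: determined_byD[OF assms(1)] determined_byD[OF assms(2)])+

lemma determined_by_next_index:
  assumes H: "\<And>i. determined_by \<Omega> idx k (H i)"
  shows "determined_by \<Omega> idx (Suc k) (\<lambda>w. H (idx k w) w)"
proof (rule determined_byI)
  fix w w' assume w: "w \<in> \<Omega>" "w' \<in> \<Omega>" "\<And>l. l < Suc k \<Longrightarrow> idx l w = idx l w'"
  have "H (idx k w) w = H (idx k w) w'"
    by (rule determined_byD[OF H]) (use w in auto)
  then show "H (idx k w) w = H (idx k w') w'"
    using w(3)[of k] by simp
qed

lemma determined_by_idx: "l < k \<Longrightarrow> determined_by \<Omega> idx k (idx l)"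
  by (simp add: determined_by_def)

definition cylinder :: "'w set \<Rightarrow> (nat \<Rightarrow> 'w \<Rightarrow> 'n) \<Rightarrow> nat \<Rightarrow> (nat \<Rightarrow> 'n) \<Rightarrow> 'w set" where
  "cylinder \<Omega> idx k c = {w \<in> \<Omega>. \<forall>l<k. idx l w = c l}"

lemma cylinder_measure:
  fixes idx :: "nat \<Rightarrow> 'w \<Rightarrow> 'n::finite"
  assumes idx: "iid_uniform P idx"
  shows "cylinder (space P) idx k c \<in> sets P"
    and "measure P (cylinder (space P) idx k c) = (1 / real CARD('n)) ^ k"
proof -
  interpret prob_space P
    using idx by (simp add: iid_uniform_def)
  have ind: "indep_vars (\<lambda>_. count_space UNIV) idx UNIV"
    using idx by (simp add: iid_uniform_def)
  have rv: "idx l \<in> measurable P (count_space UNIV)" for l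
    using ind by (simp add: indep_vars_def)
  show "cylinder (space P) idx k c \<in> sets P"
    unfolding cylinder_def using rv by measurable
  have one: "measure P (idx l -` {a} \<inter> space P) = 1 / real CARD('n)" for l a
  proof -
    have "measure P (idx l -` {a} \<inter> space P) = measure (distr P (count_space UNIV) (idx l)) {a}"
      by (rule measure_distr[symmetric]) (use rv in auto)
    also have "\<dots> = measure (uniform_count_measure UNIV) {a}"
      using idx by (simp add: iid_uniform_def)
    also have "\<dots> = 1 / real CARD('n)"
      by (subst measure_uniform_count_measure) auto
    finally show ?thesis .
  qed
  show "measure P (cylinder (space P) idx k c) = (1 / real CARD('n)) ^ k"
  proof (cases "k = 0")
    case True
    then show ?thesis by (simp add: cylinder_def prob_space)
  next
    case False
    have "cylinder (space P) idx k c = (\<Inter>l\<in>{..<k}. idx l -` {c l} \<inter> space P)"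
      using False by (auto simp: cylinder_def)
    also have "measure P \<dots> = (\<Prod>l\<in>{..<k}. measure P (idx l -` {c l} \<inter> space P))"
      by (rule indep_varsD[OF ind]) (use False in auto)
    finally show ?thesis
      by (simp add: one)
  qed
qed

lemma determined_by_simple:
  fixes idx :: "nat \<Rightarrow> 'w \<Rightarrow> 'n::finite" and F :: "'w \<Rightarrow> real"
  assumes F: "determined_by \<Omega> idx k F"
  obtains \<phi> where "\<And>w. w \<in> \<Omega> \<Longrightarrow>
    F w = (\<Sum>c\<in>{..<k} \<rightarrow>\<^sub>E UNIV. \<phi> c * indicator (cylinder \<Omega> idx k c) w)"
proof
  \<comment> \<open>any point represents its cylinder; an empty cylinder gets an arbitrary value that is never used\<close>
  define \<phi> where "\<phi> c = F (SOME w. w \<in> cylinder \<Omega> idx k c)" for c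
  fix w assume w: "w \<in> \<Omega>"
  define c where "c = restrict (\<lambda>l. idx l w) {..<k}"
  have fin: "finite ({..<k} \<rightarrow>\<^sub>E (UNIV :: 'n set))"
    by (intro finite_PiE) auto
  have c: "c \<in> {..<k} \<rightarrow>\<^sub>E UNIV"
    by (simp add: c_def)
  have wc: "w \<in> cylinder \<Omega> idx k c"
    using w by (simp add: cylinder_def c_def)
  have uniq: "c' = c" if "c' \<in> {..<k} \<rightarrow>\<^sub>E UNIV" "w \<in> cylinder \<Omega> idx k c'" for c'
    using that c by (intro PiE_ext[of c' "{..<k}" "\<lambda>_. UNIV"]) (auto simp: cylinder_def c_def)
  have "(\<Sum>c'\<in>{..<k} \<rightarrow>\<^sub>E UNIV. \<phi> c' * indicator (cylinder \<Omega> idx k c') w)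
      = (\<Sum>c'\<in>{..<k} \<rightarrow>\<^sub>E UNIV. if c' = c then \<phi> c else 0)"
  proof (rule sum.cong[OF refl])
    fix c' assume c': "c' \<in> {..<k} \<rightarrow>\<^sub>E (UNIV :: 'n set)"
    show "\<phi> c' * indicator (cylinder \<Omega> idx k c') w = (if c' = c then \<phi> c else 0)"
    proof (cases "c' = c")
      case True
      then show ?thesis using wc by simp
    next
      case False
      then have "w \<notin> cylinder \<Omega> idx k c'"
        using uniq[OF c'] by blast
      then show ?thesis using False by simp
    qed
  qed
  also have "\<dots> = \<phi> c"
    using fin c by simp
  also have "\<dots> = F w"
  proof -
    have "(SOME w. w \<in> cylinder \<Omega> idx k c) \<in> cylinder \<Omega> idx k c"
      using wc by (rule someI)
    then show ?thesis
      unfolding \<phi>_def by (intro determined_byD[OF F]) (use wc in \<open>auto simp: cylinder_def\<close>)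
  qed
  finally show "F w = (\<Sum>c\<in>{..<k} \<rightarrow>\<^sub>E UNIV. \<phi> c * indicator (cylinder \<Omega> idx k c) w)" ..
qed

lemma integrable_determined_by:
  fixes idx :: "nat \<Rightarrow> 'w \<Rightarrow> 'n::finite" and F :: "'w \<Rightarrow> real"
  assumes idx: "iid_uniform P idx" and F: "determined_by (space P) idx k F"
  shows "integrable P F"
proof -
  interpret prob_space P
    using idx by (simp add: iid_uniform_def)
  obtain \<phi> where \<phi>: "\<And>w. w \<in> space P \<Longrightarrow>
      F w = (\<Sum>c\<in>{..<k} \<rightarrow>\<^sub>E UNIV. \<phi> c * indicator (cylinder (space P) idx k c) w)"
    using determined_by_simple[OF F] by metis
  have "integrable P (\<lambda>w. \<Sum>c\<in>{..<k} \<rightarrow>\<^sub>E UNIV. \<phi> c * indicator (cylinder (space P) idx k c) w)"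
    by (intro Bochner_Integration.integrable_sum integrable_mult_right integrable_real_indicator
        cylinder_measure(1)[OF idx]) (simp add: emeasure_eq_measure)
  then show ?thesis
    by (subst Bochner_Integration.integrable_cong[OF refl \<phi>])
qed

text \<open>The index chosen at time \<open>k\<close> is uniform and independent of the first \<open>k\<close> indices. On indicators of
  cylinders this says that fixing one further index divides the probability by the number of
  robots; the general case is a finite linear combination.\<close>

lemma expectation_next_index:
  fixes idx :: "nat \<Rightarrow> 'w \<Rightarrow> 'n::finite" and H :: "'n \<Rightarrow> 'w \<Rightarrow> real"
  assumes idx: "iid_uniform P idx" and H: "\<And>i. determined_by (space P) idx k (H i)"
  shows "(\<integral>w. H (idx k w) w \<partial>P) = (\<Sum>i\<in>UNIV. \<integral>w. H i w \<partial>P) / real CARD('n)"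
proof -
  interpret prob_space P
    using idx by (simp add: iid_uniform_def)
  have "(\<integral>w. H i w * of_bool (idx k w = i) \<partial>P) = (\<integral>w. H i w \<partial>P) / real CARD('n)" for i
  proof -
    obtain \<phi> where \<phi>: "\<And>w. w \<in> space P \<Longrightarrow>
        H i w = (\<Sum>c\<in>{..<k} \<rightarrow>\<^sub>E UNIV. \<phi> c * indicator (cylinder (space P) idx k c) w)"
      using determined_by_simple[OF H] by metis
    have int: "(\<integral>w. (\<Sum>c\<in>{..<k} \<rightarrow>\<^sub>E UNIV. \<phi> c * indicator (A c) w) \<partial>P)
        = (\<Sum>c\<in>{..<k} \<rightarrow>\<^sub>E UNIV. \<phi> c * measure P (A c))"
      if "\<And>c. A c \<in> sets P" for A
    proof (subst Bochner_Integration.integral_sum)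
      show "integrable P (\<lambda>w. \<phi> c * indicator (A c) w)" for c
        using that by (intro integrable_mult_right integrable_real_indicator) (simp_all add: emeasure_eq_measure)
      show "(\<Sum>c\<in>{..<k} \<rightarrow>\<^sub>E UNIV. \<integral>w. \<phi> c * indicator (A c) w \<partial>P)
          = (\<Sum>c\<in>{..<k} \<rightarrow>\<^sub>E UNIV. \<phi> c * measure P (A c))"
        using sets.sets_into_space[OF that] by (simp add: Int_absorb2)
    qed
    have "(\<integral>w. H i w * of_bool (idx k w = i) \<partial>P)
        = (\<integral>w. (\<Sum>c\<in>{..<k} \<rightarrow>\<^sub>E UNIV. \<phi> c * indicator (cylinder (space P) idx (Suc k) (c(k := i))) w) \<partial>P)"
    proof (rule Bochner_Integration.integral_cong[OF refl])
      fix w assume "w \<in> space P"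
      have "indicator (cylinder (space P) idx k c) w * of_bool (idx k w = i)
          = (indicator (cylinder (space P) idx (Suc k) (c(k := i))) w :: real)" for c
        by (auto simp: indicator_def cylinder_def less_Suc_eq)
      then show "H i w * of_bool (idx k w = i)
          = (\<Sum>c\<in>{..<k} \<rightarrow>\<^sub>E UNIV. \<phi> c * indicator (cylinder (space P) idx (Suc k) (c(k := i))) w)"
        by (simp add: \<phi>[OF \<open>w \<in> space P\<close>] sum_distrib_right mult.assoc)
    qed
    also have "\<dots> = (\<Sum>c\<in>{..<k} \<rightarrow>\<^sub>E UNIV. \<phi> c * (1 / real CARD('n)) ^ k) / real CARD('n)"
      by (subst int) (simp_all add: cylinder_measure[OF idx] sum_divide_distrib)
    also have "(\<Sum>c\<in>{..<k} \<rightarrow>\<^sub>E UNIV. \<phi> c * (1 / real CARD('n)) ^ k) = (\<integral>w. H i w \<partial>P)"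
      by (subst Bochner_Integration.integral_cong[OF refl \<phi>], assumption, subst int)
        (simp_all add: cylinder_measure[OF idx])
    finally show ?thesis .
  qed
  moreover have "(\<integral>w. H (idx k w) w \<partial>P) = (\<integral>w. (\<Sum>i\<in>UNIV. H i w * of_bool (idx k w = i)) \<partial>P)"
    by (intro Bochner_Integration.integral_cong refl) (simp add: of_bool_def if_distrib cong: if_cong)
  moreover have "\<dots> = (\<Sum>i\<in>UNIV. \<integral>w. H i w * of_bool (idx k w = i) \<partial>P)"
  proof (rule Bochner_Integration.integral_sum)
    fix i
    have "determined_by (space P) idx (Suc k) (\<lambda>w. H i w * of_bool (idx k w = i))"
      by (intro determined_by_comp2[where \<phi>="\<lambda>a b. a * of_bool (b = i)"] determined_by_idx
          determined_by_mono[OF H]) auto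
    then show "integrable P (\<lambda>w. H i w * of_bool (idx k w = i))"
      by (rule integrable_determined_by[OF idx])
  qed
  ultimately show ?thesis
    by (simp add: sum_divide_distrib)
qed

text \<open>Each index belongs to at most \<open>b\<close> of the windows.\<close>

lemma sum_window_le:
  fixes d :: "nat \<Rightarrow> real"
  assumes d: "\<And>l. d l \<ge> 0"
  shows "(\<Sum>k<K. \<Sum>l\<in>{k-b..<k}. d l) \<le> real b * (\<Sum>l<K. d l)"
proof -
  have "(\<Sum>k<K. \<Sum>l\<in>{k-b..<k}. d l) = (\<Sum>k<K. \<Sum>l\<in>{l\<in>{..<K}. l < k \<and> k \<le> l + b}. d l)"
    by (intro sum.cong) auto
  also have "\<dots> = (\<Sum>l<K. \<Sum>k\<in>{k\<in>{..<K}. l < k \<and> k \<le> l + b}. d l)"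
    by (rule sum.swap_restrict) auto
  also have "\<dots> \<le> (\<Sum>l<K. real b * d l)"
  proof (rule sum_mono)
    fix l
    have "card {k\<in>{..<K}. l < k \<and> k \<le> l + b} \<le> card {l<..l + b}"
      by (rule card_mono) auto
    then show "(\<Sum>k\<in>{k\<in>{..<K}. l < k \<and> k \<le> l + b}. d l) \<le> real b * d l"
      using d by (simp add: mult_right_mono)
  qed
  finally show ?thesis
    by (simp add: sum_distrib_left)
qed

text \<open>The probabilistic core, detached from geometry: \<open>F\<close> is the cost, \<open>D\<close> the squared displacement, \<open>g k i\<close>
  the squared norm of the gradient block of robot \<open>i\<close> at time \<open>k\<close>, and \<open>N\<close> the neighbourhood relation. The delay
  error at time \<open>k\<close> only sees a past displacement at time \<open>l\<close> if the robot that moved then is a neighbour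
  of the robot that moves now. The displacement is determined by the first \<open>l + 1 \<le> k\<close> indices, so given
  the past this event has probability at most \<open>m / n\<close> for \<open>n\<close> robots. Summing over time, every
  displacement is charged at most \<open>b\<close> times, and the assumption on \<open>a\<close> says that its own decrease
  pays for these charges. What remains telescopes.\<close>

lemma asynchronous_rate:
  fixes idx :: "nat \<Rightarrow> 'w \<Rightarrow> 'n::finite" and N :: "'n \<Rightarrow> 'n set"
    and F :: "nat \<Rightarrow> 'w \<Rightarrow> real" and D :: "nat \<Rightarrow> 'w \<Rightarrow> real" and g :: "nat \<Rightarrow> 'n \<Rightarrow> 'w \<Rightarrow> real"
  assumes idx: "iid_uniform P idx"
    and F: "\<And>k. determined_by (space P) idx k (F k)"
    and D: "\<And>k. determined_by (space P) idx (Suc k) (D k)" "\<And>k w. D k w \<ge> 0"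
    and g: "\<And>k i. determined_by (space P) idx k (g k i)"
    and sym: "\<And>i j. j \<in> N i \<longleftrightarrow> i \<in> N j" and deg: "\<And>i. card (N i) \<le> m"
    and c: "c \<ge> 0" "c * real b * (real m / real CARD('n)) \<le> a"
    and step: "\<And>k w. w \<in> space P \<Longrightarrow> F (Suc k) w \<le> F k w - \<beta> * g k (idx k w) w - a * D k w
        + c * (\<Sum>l\<in>{k-b..<k}. of_bool (idx l w \<in> N (idx k w)) * D l w)"
    and bound: "\<And>k w. w \<in> space P \<Longrightarrow> fmin \<le> F k w" and init: "\<And>w. w \<in> space P \<Longrightarrow> F 0 w = F0"
  shows "\<beta> * (\<Sum>k<K. \<integral>w. (\<Sum>i\<in>UNIV. g k i w) \<partial>P) \<le> real CARD('n) * (F0 - fmin)"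
proof -
  interpret prob_space P
    using idx by (simp add: iid_uniform_def)
  let ?n = "real CARD('n)"
  have n: "?n > 0"
    by simp
  note int = integrable_determined_by[OF idx]
  define d where "d k = (\<integral>w. D k w \<partial>P)" for k
  define G where "G k = (\<integral>w. (\<Sum>i\<in>UNIV. g k i w) \<partial>P)" for k
  have d0: "d k \<ge> 0" for k
    unfolding d_def by (intro integral_nonneg_AE) (simp add: D)
  have gdet: "determined_by (space P) idx (Suc k) (\<lambda>w. g k (idx k w) w)" for k
    by (rule determined_by_next_index[OF g])
  have Eg: "(\<integral>w. g k (idx k w) w \<partial>P) = G k / ?n" for k
    unfolding G_def by (subst expectation_next_index[OF idx g], subst Bochner_Integration.integral_sum)
      (auto intro: int[OF g])
  have Wdet: "determined_by (space P) idx k (\<lambda>w. of_bool (idx l w \<in> N i) * D l w)" if "l < k" for k l i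
    by (intro determined_by_comp2[where \<phi>="\<lambda>a b. of_bool (a \<in> N i) * b"] determined_by_idx that
        determined_by_mono[OF D(1)]) (use that in auto)
  have Wdet': "determined_by (space P) idx (Suc k) (\<lambda>w. of_bool (idx l w \<in> N (idx k w)) * D l w)"
    if "l < k" for k l
    by (rule determined_by_next_index[OF Wdet[OF that]])
  \<comment> \<open>symmetry turns the number of robots that have the mover as a neighbour into its degree\<close>
  have EW: "(\<integral>w. of_bool (idx l w \<in> N (idx k w)) * D l w \<partial>P) \<le> real m / ?n * d l" if "l < k" for k l
  proof -
    have "(\<integral>w. of_bool (idx l w \<in> N (idx k w)) * D l w \<partial>P)
        = (\<Sum>i\<in>UNIV. \<integral>w. of_bool (idx l w \<in> N i) * D l w \<partial>P) / ?n"
      by (rule expectation_next_index[OF idx Wdet[OF that]])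
    also have "(\<Sum>i\<in>UNIV. \<integral>w. of_bool (idx l w \<in> N i) * D l w \<partial>P)
        = (\<integral>w. (\<Sum>i\<in>UNIV. of_bool (idx l w \<in> N i) * D l w) \<partial>P)"
      by (rule Bochner_Integration.integral_sum[symmetric]) (rule int[OF Wdet[OF that]])
    also have "\<dots> = (\<integral>w. real (card (N (idx l w))) * D l w \<partial>P)"
      by (intro Bochner_Integration.integral_cong refl)
        (simp add: sum_distrib_right[symmetric] sym[of "idx l _"] of_bool_def sum.If_cases)
    also have "\<dots> \<le> (\<integral>w. real m * D l w \<partial>P)"
    proof (rule integral_mono)
      have "determined_by (space P) idx (Suc l) (\<lambda>w. real (card (N (idx l w))) * D l w)"
        by (intro determined_by_comp2[where \<phi>="\<lambda>a b. real (card (N a)) * b"] determined_by_idx D) simp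
      then show "integrable P (\<lambda>w. real (card (N (idx l w))) * D l w)"
        by (rule int)
      show "integrable P (\<lambda>w. real m * D l w)"
        by (intro integrable_mult_right int[OF D(1)])
      show "real (card (N (idx l w))) * D l w \<le> real m * D l w" for w
        using deg D(2) by (intro mult_right_mono) auto
    qed
    also have "\<dots> = real m * d l"
      by (simp add: d_def)
    finally show ?thesis
      using n by (simp add: divide_right_mono)
  qed
  define S where "S k w = (\<Sum>l\<in>{k-b..<k}. of_bool (idx l w \<in> N (idx k w)) * D l w)" for k w
  have intS: "integrable P (S k)" for k
    unfolding S_def by (intro Bochner_Integration.integrable_sum int[OF Wdet']) auto
  have ES: "(\<integral>w. S k w \<partial>P) = (\<Sum>l\<in>{k-b..<k}. \<integral>w. of_bool (idx l w \<in> N (idx k w)) * D l w \<partial>P)" for k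
    unfolding S_def by (intro Bochner_Integration.integral_sum int[OF Wdet']) auto
  have Estep: "(\<integral>w. F (Suc k) w \<partial>P) \<le> (\<integral>w. F k w \<partial>P) - \<beta> * (G k / ?n) - a * d k
      + c * (\<Sum>l\<in>{k-b..<k}. real m / ?n * d l)" for k
  proof -
    have "(\<integral>w. F (Suc k) w \<partial>P)
        \<le> (\<integral>w. F k w - \<beta> * g k (idx k w) w - a * D k w + c * S k w \<partial>P)"
      using step[of _ k] unfolding S_def[symmetric]
      by (intro integral_mono int[OF F] Bochner_Integration.integrable_add intS
          Bochner_Integration.integrable_diff integrable_mult_right int[OF gdet] int[OF D(1)])
    also have "\<dots> = (\<integral>w. F k w \<partial>P) - \<beta> * (G k / ?n) - a * d k + c * (\<integral>w. S k w \<partial>P)"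
      using int[OF F] int[OF gdet] int[OF D(1)] intS by (simp add: Eg d_def)
    also have "\<dots> = (\<integral>w. F k w \<partial>P) - \<beta> * (G k / ?n) - a * d k
        + c * (\<Sum>l\<in>{k-b..<k}. \<integral>w. of_bool (idx l w \<in> N (idx k w)) * D l w \<partial>P)"
      by (simp only: ES)
    also have "\<dots> \<le> (\<integral>w. F k w \<partial>P) - \<beta> * (G k / ?n) - a * d k
        + c * (\<Sum>l\<in>{k-b..<k}. real m / ?n * d l)"
      using c(1) by (intro add_left_mono mult_left_mono sum_mono EW) auto
    finally show ?thesis .
  qed
  have "(\<integral>w. F K w \<partial>P) \<le> F0 - \<beta> * (\<Sum>k<K. G k) / ?n - a * (\<Sum>k<K. d k)
      + c * (real m / ?n) * (\<Sum>k<K. \<Sum>l\<in>{k-b..<k}. d l)"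
  proof (induction K)
    case 0
    have "(\<integral>w. F 0 w \<partial>P) = (\<integral>w. F0 \<partial>P)"
      by (intro Bochner_Integration.integral_cong refl init)
    then show ?case by (simp add: prob_space)
  next
    case (Suc K)
    have "c * (\<Sum>l\<in>{K-b..<K}. real m / ?n * d l) = c * (real m / ?n) * (\<Sum>l\<in>{K-b..<K}. d l)"
      by (simp only: sum_distrib_left mult.assoc)
    moreover have "\<beta> * (\<Sum>k<Suc K. G k) / ?n = \<beta> * (\<Sum>k<K. G k) / ?n + \<beta> * (G K / ?n)"
      by (simp add: distrib_left add_divide_distrib)
    moreover note Suc Estep[of K]
    ultimately show ?case
      by (simp only: sum.lessThan_Suc distrib_left)
  qed
  moreover have "c * (real m / ?n) * (\<Sum>k<K. \<Sum>l\<in>{k-b..<k}. d l) \<le> a * (\<Sum>k<K. d k)"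
  proof -
    have "c * (real m / ?n) * (\<Sum>k<K. \<Sum>l\<in>{k-b..<k}. d l) \<le> c * (real m / ?n) * (real b * (\<Sum>k<K. d k))"
      using c(1) n by (intro mult_left_mono sum_window_le d0) auto
    also have "\<dots> = c * real b * (real m / ?n) * (\<Sum>k<K. d k)"
      by simp
    also have "\<dots> \<le> a * (\<Sum>k<K. d k)"
      using c(2) by (intro mult_right_mono sum_nonneg d0)
    finally show ?thesis .
  qed
  moreover have "fmin \<le> (\<integral>w. F K w \<partial>P)"
  proof -
    have "(\<integral>w. fmin \<partial>P) \<le> (\<integral>w. F K w \<partial>P)"
      by (intro integral_mono int[OF F] bound) auto
    then show ?thesis by (simp add: prob_space)
  qed
  ultimately have "\<beta> * (\<Sum>k<K. G k) / ?n \<le> F0 - fmin"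
    by linarith
  then show ?thesis
    using n by (simp add: G_def field_simps)
qed

section \<open>Convergence rate\<close>

lemma neighbors_sym: "j \<in> neighbors G i \<longleftrightarrow> i \<in> neighbors G j"
  by (auto simp: neighbors_def edges_between_def insert_commute)

lemma card_neighbors_le: "card (neighbors G i) \<le> max_degree G"
  unfolding max_degree_def by (rule Max_ge) auto

text \<open>An outdated variable differs from the current one by the moves made in between. Cauchy-Schwarz costs
  the factor \<open>b\<close>; since a robot's variable changes only when that robot is selected, summing over the
  robots in \<open>A\<close> charges each displacement at most once.\<close>

lemma stale_copy_error:
  fixes G :: "('v::finite, 'n::finite, 'd::finite) pose_graph"
    and x :: "nat \<Rightarrow> ('d, 'r::finite, 'v) config"
  assumes frozen: "\<And>l j. j \<noteq> i l \<Longrightarrow> block G j (x (Suc l)) = block G j (x l)"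
    and \<delta>: "\<And>j. j \<in> A \<Longrightarrow> \<delta> j \<le> k" "\<And>j. j \<in> A \<Longrightarrow> \<delta> j \<le> b"
  shows "(\<Sum>j\<in>A. (norm (block G j (x (k - \<delta> j) - x k)))\<^sup>2)
    \<le> real b * (\<Sum>l\<in>{k-b..<k}. of_bool (i l \<in> A) * (norm (x (Suc l) - x l))\<^sup>2)"
proof -
  let ?s = "\<lambda>l. (norm (x (Suc l) - x l))\<^sup>2"
  have "(norm (block G j (x (k - \<delta> j) - x k)))\<^sup>2 \<le> real b * (\<Sum>l\<in>{k-b..<k}. of_bool (i l = j) * ?s l)"
    if j: "j \<in> A" for j
  proof -
    let ?u = "\<lambda>l. block G j (x (Suc l) - x l)" and ?I = "{k - \<delta> j..<k}"
    have "x k - x (k - \<delta> j) = (\<Sum>l\<in>?I. x (Suc l) - x l)"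
      by (rule sum_Suc_diff'[symmetric]) simp
    then have "block G j (x k - x (k - \<delta> j)) = (\<Sum>l\<in>?I. ?u l)"
      by (simp only: linear_sum[OF linear_block])
    moreover have "norm (block G j (x (k - \<delta> j) - x k)) = norm (block G j (x k - x (k - \<delta> j)))"
      by (simp only: linear_diff[OF linear_block] norm_minus_commute)
    ultimately have "(norm (block G j (x (k - \<delta> j) - x k)))\<^sup>2 = (norm (\<Sum>l\<in>?I. ?u l))\<^sup>2"
      by simp
    also have "\<dots> \<le> (\<Sum>l\<in>?I. norm (?u l))\<^sup>2"
      by (intro power_mono norm_sum) auto
    also have "\<dots> \<le> (\<Sum>l\<in>?I. (norm (?u l))\<^sup>2) * card ?I"
      by (rule sum_squared_le_sum_of_squares)
    also have "\<dots> \<le> (\<Sum>l\<in>?I. of_bool (i l = j) * ?s l) * real b"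
    proof (rule mult_mono)
      have "(norm (?u l))\<^sup>2 \<le> of_bool (i l = j) * ?s l" for l
      proof (cases "i l = j")
        case True
        then show ?thesis by (simp add: power_mono norm_block_le)
      next
        case False
        then have "?u l = 0"
          using frozen[of j l] by (simp add: linear_diff[OF linear_block])
        then show ?thesis using False by simp
      qed
      then show "(\<Sum>l\<in>?I. (norm (?u l))\<^sup>2) \<le> (\<Sum>l\<in>?I. of_bool (i l = j) * ?s l)"
        by (rule sum_mono)
    qed (use \<delta>[OF j] in \<open>auto intro!: sum_nonneg\<close>)
    also have "\<dots> \<le> (\<Sum>l\<in>{k-b..<k}. of_bool (i l = j) * ?s l) * real b"
      using \<delta>[OF j] by (intro mult_right_mono sum_mono2) auto
    finally show ?thesis
      by (simp only: mult.commute)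
  qed
  then have "(\<Sum>j\<in>A. (norm (block G j (x (k - \<delta> j) - x k)))\<^sup>2)
      \<le> (\<Sum>j\<in>A. real b * (\<Sum>l\<in>{k-b..<k}. of_bool (i l = j) * ?s l))"
    by (rule sum_mono)
  also have "\<dots> = real b * (\<Sum>l\<in>{k-b..<k}. \<Sum>j\<in>A. of_bool (i l = j) * ?s l)"
    by (simp only: sum_distrib_left[symmetric]) (subst sum.swap, rule refl)
  also have "\<dots> = real b * (\<Sum>l\<in>{k-b..<k}. of_bool (i l \<in> A) * ?s l)"
  proof -
    have "(\<Sum>j\<in>A. of_bool (i l = j) * ?s l) = of_bool (i l \<in> A) * ?s l" for l
      by (simp add: sum_distrib_right[symmetric] of_bool_def)
    then show ?thesis by presburger
  qed
  finally show ?thesis .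
qed

text \<open>Both optimization problems are covered at once: the argument asks of the set \<open>Q\<close> of admissible
  matrices that its tangent spaces are subspaces.\<close>

theorem asapp_rate:
  fixes G :: "('v::finite, 'n::finite, 'd::finite) pose_graph"
    and x :: "nat \<Rightarrow> 'w \<Rightarrow> ('d, 'r::finite, 'v) config"
    and Retr :: "'n \<Rightarrow> ('d, 'r, 'v) config \<Rightarrow> ('d, 'r, 'v) config \<Rightarrow> ('d, 'r, 'v) config"
  assumes Q: "\<And>Y. Y \<in> Q \<Longrightarrow> subspace (tangent_space Q Y)"
    and idx: "iid_uniform P idx"
    and \<alpha>: "\<alpha> > 0" and B: "B \<ge> 0" and \<gamma>: "\<gamma> > 0"
    and step_size: "real (max_degree G) / real CARD('n) * \<alpha>\<^sup>2 * B\<^sup>2 * L\<^sup>2 * \<gamma>\<^sup>2 + L * \<gamma> \<le> 1"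
    and retr: "\<And>i. manifold_retraction (robot_manifold G Q i) (Retr i)"
    and descent: "descent_constant G Q Retr L" and retr_bound: "retr_bound G Q Retr \<alpha>"
    and fstar: "\<And>y. y \<in> joint_manifold G Q \<Longrightarrow> fstar \<le> cost G y"
    and x0: "x0 \<in> joint_manifold G Q"
    and iter: "asapp_iteration G Q Retr \<gamma> (space P) idx delay x0 x"
    and delay: "bounded_delay G (space P) idx delay B"
    and K: "K \<ge> 1"
  shows "(MIN k\<in>{0..K-1}. \<integral>w. (norm (riemannian_grad (joint_manifold G Q) (cost G) (x k w)))\<^sup>2 \<partial>P)
    \<le> 2 * real CARD('n) * (cost G x0 - fstar) / (\<gamma> * real K)"
proof -
  let ?\<rho> = "real (max_degree G) / real CARD('n)"
  let ?grad = "riemannian_grad (joint_manifold G Q) (cost G)"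
  \<comment> \<open>the integral delay bound\<close>
  define b where "b = nat \<lfloor>B\<rfloor>"
  have b: "real b \<le> B"
    using B by (simp add: b_def)
  define a where "a = (1 - L * \<gamma>) / (2 * \<gamma> * \<alpha>\<^sup>2)"
  \<comment> \<open>the factor \<open>b\<close> comes from Cauchy-Schwarz in the error of the outdated copies\<close>
  define c where "c = \<gamma> / 2 * L\<^sup>2 * real b"
  have "?\<rho> * \<alpha>\<^sup>2 * B\<^sup>2 * L\<^sup>2 * \<gamma>\<^sup>2 \<ge> 0"
    by simp
  then have L\<gamma>: "L * \<gamma> \<le> 1"
    using step_size by linarith
  have start: "x 0 w = x0" if "w \<in> space P" for w
    using iter that unfolding asapp_iteration_def by (elim conjE) (rule bspec)
  have delay_le: "delay k j w \<le> k" "delay k j w \<le> b" if "w \<in> space P" "j \<in> neighbors G (idx k w)" for k j w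
  proof -
    show "delay k j w \<le> k"
      using iter that unfolding asapp_iteration_def by (elim conjE) (drule (1) bspec, blast)
    have "real (delay k j w) \<le> B"
      using delay that unfolding bounded_delay_def by blast
    then show "delay k j w \<le> b"
      unfolding b_def by (rule le_nat_floor)
  qed
  define xh where "xh k w j = block G j (x (k - delay k j w) w)" for k w j
  define \<eta> where "\<eta> k w = riemannian_grad (robot_manifold G Q (idx k w)) (local_cost G (idx k w) (xh k w))
      (block G (idx k w) (x k w))" for k w
  have update: "block G (idx k w) (x (Suc k) w) = Retr (idx k w) (block G (idx k w) (x k w)) (- \<gamma> *\<^sub>R \<eta> k w)"
    and frozen: "j \<noteq> idx k w \<Longrightarrow> block G j (x (Suc k) w) = block G j (x k w)"
    if "w \<in> space P" for k w j
  proof -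
    have "\<forall>w\<in>space P. \<forall>k.
        block G (idx k w) (x (Suc k) w) = Retr (idx k w) (block G (idx k w) (x k w)) (- \<gamma> *\<^sub>R \<eta> k w) \<and>
        (\<forall>j. j \<noteq> idx k w \<longrightarrow> block G j (x (Suc k) w) = block G j (x k w))"
      using iter unfolding asapp_iteration_def Let_def \<eta>_def xh_def[abs_def] by (elim conjE)
    then show "block G (idx k w) (x (Suc k) w)
        = Retr (idx k w) (block G (idx k w) (x k w)) (- \<gamma> *\<^sub>R \<eta> k w)"
      "j \<noteq> idx k w \<Longrightarrow> block G j (x (Suc k) w) = block G j (x k w)"
      using that by blast+
  qed
  have det: "determined_by (space P) idx k (x k)" for k
    using iter unfolding asapp_iteration_def determined_by_def by (elim conjE) (rule spec)
  note block_step = asynchronous_block_step[OF Q _ retr descent retr_bound \<gamma> L\<gamma> \<alpha> \<eta>_def]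
  have joint: "x k w \<in> joint_manifold G Q" if "w \<in> space P" for k w
  proof (induction k)
    case 0
    then show ?case using x0 start[OF that] by simp
  next
    case (Suc k)
    show ?case
      by (rule block_step(1)[OF _ Suc update[OF that] frozen[OF that]])
  qed
  have one_step: "cost G (x (Suc k) w) \<le> cost G (x k w)
      - \<gamma> / 2 * (norm (block G (idx k w) (?grad (x k w))))\<^sup>2 - a * (norm (x (Suc k) w - x k w))\<^sup>2
      + c * (\<Sum>l\<in>{k-b..<k}. of_bool (idx l w \<in> neighbors G (idx k w)) * (norm (x (Suc l) w - x l w))\<^sup>2)"
    if w: "w \<in> space P" for k w
  proof -
    let ?N = "neighbors G (idx k w)"
    have "block G j (xh k w j - x k w) = block G j (x (k - delay k j w) w - x k w)" for j
      by (simp add: xh_def linear_diff[OF linear_block] block_block)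
    then have "(\<Sum>j\<in>?N. (norm (block G j (xh k w j - x k w)))\<^sup>2)
        = (\<Sum>j\<in>?N. (norm (block G j (x (k - delay k j w) w - x k w)))\<^sup>2)"
      by simp
    also have "\<dots> \<le> real b * (\<Sum>l\<in>{k-b..<k}. of_bool (idx l w \<in> ?N) * (norm (x (Suc l) w - x l w))\<^sup>2)"
      using stale_copy_error[where x = "\<lambda>k. x k w" and i = "\<lambda>l. idx l w" and \<delta> = "\<lambda>j. delay k j w" and A = ?N]
        frozen[OF w] delay_le[OF w] by blast
    finally have "\<gamma> / 2 * L\<^sup>2 * (\<Sum>j\<in>?N. (norm (block G j (xh k w j - x k w)))\<^sup>2)
        \<le> \<gamma> / 2 * L\<^sup>2 * (real b * (\<Sum>l\<in>{k-b..<k}. of_bool (idx l w \<in> ?N) * (norm (x (Suc l) w - x l w))\<^sup>2))"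
      using \<gamma> by (intro mult_left_mono) auto
    moreover have "cost G (x (Suc k) w) \<le> cost G (x k w)
        - \<gamma> / 2 * (norm (block G (idx k w) (?grad (x k w))))\<^sup>2 - a * (norm (x (Suc k) w - x k w))\<^sup>2
        + \<gamma> / 2 * L\<^sup>2 * (\<Sum>j\<in>?N. (norm (block G j (xh k w j - x k w)))\<^sup>2)"
      unfolding a_def by (rule block_step(2)[OF _ joint[OF w] update[OF w] frozen[OF w]])
    ultimately show ?thesis
      by (simp only: c_def mult.assoc)
  qed
  have "c * real b * ?\<rho> \<le> a"
  proof -
    have "?\<rho> * \<alpha>\<^sup>2 * (real b)\<^sup>2 * L\<^sup>2 * \<gamma>\<^sup>2 \<le> ?\<rho> * \<alpha>\<^sup>2 * B\<^sup>2 * L\<^sup>2 * \<gamma>\<^sup>2"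
      using b by (intro mult_right_mono mult_left_mono power_mono) auto
    then have "?\<rho> * \<alpha>\<^sup>2 * (real b)\<^sup>2 * L\<^sup>2 * \<gamma>\<^sup>2 \<le> 1 - L * \<gamma>"
      using step_size by linarith
    moreover have "c * real b * ?\<rho> * (2 * \<gamma> * \<alpha>\<^sup>2) = ?\<rho> * \<alpha>\<^sup>2 * (real b)\<^sup>2 * L\<^sup>2 * \<gamma>\<^sup>2"
      by (simp add: c_def power2_eq_square)
    ultimately have "c * real b * ?\<rho> * (2 * \<gamma> * \<alpha>\<^sup>2) \<le> 1 - L * \<gamma>"
      by (simp only:)
    moreover have "2 * \<gamma> * \<alpha>\<^sup>2 > 0"
      using \<gamma> \<alpha> by simp
    ultimately show ?thesis
      unfolding a_def by (simp only: pos_le_divide_eq)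
  qed
  note balance = this
  have "\<gamma> / 2 * (\<Sum>k<K. \<integral>w. (\<Sum>i\<in>UNIV. (norm (block G i (?grad (x k w))))\<^sup>2) \<partial>P)
      \<le> real CARD('n) * (cost G x0 - fstar)"
  proof (rule asynchronous_rate[where F = "\<lambda>k w. cost G (x k w)" and N = "neighbors G" and b = b])
    show "determined_by (space P) idx k (\<lambda>w. cost G (x k w))" for k
      by (rule determined_by_comp[OF det])
    show "determined_by (space P) idx (Suc k) (\<lambda>w. (norm (x (Suc k) w - x k w))\<^sup>2)" for k
      by (rule determined_by_comp2[where \<phi> = "\<lambda>y z. (norm (y - z))\<^sup>2", OF det determined_by_mono[OF det]])
        simp
    show "determined_by (space P) idx k (\<lambda>w. (norm (block G i (?grad (x k w))))\<^sup>2)" for k i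
      by (rule determined_by_comp[OF det])
    show "c \<ge> 0"
      using \<gamma> by (simp add: c_def)
    show "j \<in> neighbors G i \<longleftrightarrow> i \<in> neighbors G j" for i j
      by (rule neighbors_sym)
    show "fstar \<le> cost G (x k w)" if "w \<in> space P" for k w
      by (rule fstar[OF joint[OF that]])
    show "cost G (x 0 w) = cost G x0" if "w \<in> space P" for w
      by (simp only: start[OF that])
  qed (rule idx card_neighbors_le balance one_step | simp)+
  then have total: "\<gamma> / 2 * (\<Sum>k<K. \<integral>w. (norm (?grad (x k w)))\<^sup>2 \<partial>P) \<le> real CARD('n) * (cost G x0 - fstar)"
    by (simp only: norm_square_blocks[symmetric])
  let ?E = "\<lambda>k. \<integral>w. (norm (?grad (x k w)))\<^sup>2 \<partial>P"
  have "real K * (MIN k\<in>{0..K-1}. ?E k) = (\<Sum>k<K. MIN k\<in>{0..K-1}. ?E k)"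
    by simp
  also have "\<dots> \<le> (\<Sum>k<K. ?E k)"
    using K by (intro sum_mono Min_le) auto
  finally have "\<gamma> / 2 * (real K * (MIN k\<in>{0..K-1}. ?E k)) \<le> \<gamma> / 2 * (\<Sum>k<K. ?E k)"
    using \<gamma> by (intro mult_left_mono) auto
  with total have "(MIN k\<in>{0..K-1}. ?E k) * (\<gamma> * real K) \<le> 2 * real CARD('n) * (cost G x0 - fstar)"
    by (simp add: algebra_simps)
  moreover have "\<gamma> * real K > 0"
    using \<gamma> K by simp
  ultimately show ?thesis
    by (simp only: pos_le_divide_eq)
qed

text \<open>With \<open>q = 2 \<rho> \<alpha>\<^sup>2 B\<^sup>2\<close>, the product \<open>L \<gamma>\<close> is the positive root of \<open>q s\<^sup>2 + s - 1\<close>; for \<open>B = 0\<close> the quadratic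
  term vanishes.\<close>

lemma step_size_choice:
  fixes \<rho> \<alpha> B L :: real
  assumes "\<rho> > 0" "\<alpha> > 0" "L > 0" "B \<ge> 0"
  defines "\<gamma> \<equiv> if B > 0 then (sqrt (1 + 8 * \<rho> * \<alpha>\<^sup>2 * B\<^sup>2) - 1) / (4 * \<rho> * \<alpha>\<^sup>2 * B\<^sup>2 * L) else 1 / L"
  shows "\<gamma> > 0 \<and> 2 * \<rho> * \<alpha>\<^sup>2 * B\<^sup>2 * L\<^sup>2 * \<gamma>\<^sup>2 + L * \<gamma> - 1 \<le> 0"
proof (cases "B > 0")
  case True
  define q where "q = 2 * \<rho> * \<alpha>\<^sup>2 * B\<^sup>2"
  have q: "q > 0"
    using assms True by (simp add: q_def)
  have \<gamma>: "\<gamma> = (sqrt (1 + 4 * q) - 1) / (2 * q) / L"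
    using True by (simp add: \<gamma>_def q_def mult.assoc)
  define s where "s = sqrt (1 + 4 * q)"
  have s: "s\<^sup>2 = 1 + 4 * q" "s > 1"
    using q by (simp_all add: s_def)
  have L\<gamma>: "L * \<gamma> = (s - 1) / (2 * q)"
    using assms(3) by (simp add: \<gamma> s_def)
  have "q * (L * \<gamma>)\<^sup>2 + L * \<gamma> - 1 = (s\<^sup>2 - (1 + 4 * q)) / (4 * q)"
    unfolding L\<gamma> using q by (simp add: field_simps power2_eq_square)
  then have "q * (L * \<gamma>)\<^sup>2 + L * \<gamma> - 1 = 0"
    using s by simp
  moreover have "\<gamma> > 0"
    using s q assms(3) by (simp add: \<gamma> s_def)
  ultimately show ?thesis
    by (simp add: q_def power_mult_distrib mult.assoc)
qed (use assms in auto)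

theorem theorem1:
  fixes G :: "('v::finite, 'n::finite, 'd::finite) pose_graph"
    and P :: "'w measure" and idx :: "nat \<Rightarrow> 'w \<Rightarrow> 'n"
    and L \<alpha> B \<rho> :: real
  assumes d: "CARD('d) \<in> {2, 3}"
    and G: "valid_pose_graph G"
    and Delta: "max_degree G > 0"
    and rho: "\<rho> = real (max_degree G) / real CARD('n)"
    and L: "L > 0" and alpha: "\<alpha> > 0" and B: "B \<ge> 0"
    and idx: "iid_uniform P idx"
  shows
    "(let \<gamma>c = (if B > 0 then (sqrt (1 + 8 * \<rho> * \<alpha>\<^sup>2 * B\<^sup>2) - 1) / (4 * \<rho> * \<alpha>\<^sup>2 * B\<^sup>2 * L)
                else 1 / L)
      in \<gamma>c > 0 \<and> 2 * \<rho> * \<alpha>\<^sup>2 * B\<^sup>2 * L\<^sup>2 * \<gamma>c\<^sup>2 + L * \<gamma>c - 1 \<le> 0)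
     \<and>
     (\<forall>\<gamma>b \<gamma>. \<gamma>b > 0 \<and> 2 * \<rho> * \<alpha>\<^sup>2 * B\<^sup>2 * L\<^sup>2 * \<gamma>b\<^sup>2 + L * \<gamma>b - 1 \<le> 0 \<and> 0 < \<gamma> \<and> \<gamma> \<le> \<gamma>b \<longrightarrow>
       \<comment> \<open>maximum likelihood problem\<close>
       (\<forall>(Retr :: 'n \<Rightarrow> ('d, 'd, 'v) config \<Rightarrow> ('d, 'd, 'v) config \<Rightarrow> ('d, 'd, 'v) config)
          fstar delay x0 x.
          (\<forall>i. manifold_retraction (robot_manifold G special_orthogonal i) (Retr i)) \<and>
          descent_constant G special_orthogonal Retr L \<and>
          retr_bound G special_orthogonal Retr \<alpha> \<and>
          (\<forall>y\<in>joint_manifold G special_orthogonal. fstar \<le> cost G y) \<and>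
          x0 \<in> joint_manifold G special_orthogonal \<and>
          asapp_iteration G special_orthogonal Retr \<gamma> (space P) idx delay x0 x \<and>
          bounded_delay G (space P) idx delay B \<longrightarrow>
          (\<forall>K\<ge>1.
            (MIN k\<in>{0..K-1}. \<integral>w. (norm (riemannian_grad (joint_manifold G special_orthogonal) (cost G) (x k w)))\<^sup>2 \<partial>P)
              \<le> 2 * real CARD('n) * (cost G x0 - fstar) / (\<gamma> * real K))) \<and>
       \<comment> \<open>rank-r relaxation, r = CARD('r)\<close>
       (\<forall>(Retr :: 'n \<Rightarrow> ('d, 'r::finite, 'v) config \<Rightarrow> ('d, 'r, 'v) config \<Rightarrow> ('d, 'r, 'v) config)
          fstar delay x0 x.
          CARD('d) \<le> CARD('r) \<and>
          (\<forall>i. manifold_retraction (robot_manifold G stiefel i) (Retr i)) \<and>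
          descent_constant G stiefel Retr L \<and>
          retr_bound G stiefel Retr \<alpha> \<and>
          (\<forall>y\<in>(joint_manifold G stiefel :: ('d, 'r, 'v) config set). fstar \<le> cost G y) \<and>
          x0 \<in> joint_manifold G stiefel \<and>
          asapp_iteration G stiefel Retr \<gamma> (space P) idx delay x0 x \<and>
          bounded_delay G (space P) idx delay B \<longrightarrow>
          (\<forall>K\<ge>1.
            (MIN k\<in>{0..K-1}. \<integral>w. (norm (riemannian_grad (joint_manifold G stiefel) (cost G) (x k w)))\<^sup>2 \<partial>P)
              \<le> 2 * real CARD('n) * (cost G x0 - fstar) / (\<gamma> * real K))))"
proof -
  let ?\<gamma>c = "if B > 0 then (sqrt (1 + 8 * \<rho> * \<alpha>\<^sup>2 * B\<^sup>2) - 1) / (4 * \<rho> * \<alpha>\<^sup>2 * B\<^sup>2 * L) else 1 / L"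
  have rho_pos: "\<rho> > 0"
    using Delta by (simp add: rho)
  have choice: "?\<gamma>c > 0 \<and> 2 * \<rho> * \<alpha>\<^sup>2 * B\<^sup>2 * L\<^sup>2 * ?\<gamma>c\<^sup>2 + L * ?\<gamma>c - 1 \<le> 0"
    using rho_pos alpha L B by (rule step_size_choice)
  have step_size: "real (max_degree G) / real CARD('n) * \<alpha>\<^sup>2 * B\<^sup>2 * L\<^sup>2 * \<gamma>\<^sup>2 + L * \<gamma> \<le> 1"
    if "2 * \<rho> * \<alpha>\<^sup>2 * B\<^sup>2 * L\<^sup>2 * \<gamma>b\<^sup>2 + L * \<gamma>b - 1 \<le> 0" "0 < \<gamma>" "\<gamma> \<le> \<gamma>b" for \<gamma>b \<gamma>
  proof -
    let ?q = "\<rho> * \<alpha>\<^sup>2 * B\<^sup>2 * L\<^sup>2"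
    have "?q \<ge> 0"
      using rho_pos by simp
    then have "?q * \<gamma>\<^sup>2 \<le> ?q * \<gamma>b\<^sup>2" "?q * \<gamma>b\<^sup>2 \<ge> 0"
      using that by (auto intro!: mult_left_mono power_mono)
    moreover have "L * \<gamma> \<le> L * \<gamma>b"
      using that L by simp
    ultimately show ?thesis
      using that(1) unfolding rho[symmetric] by linarith
  qed
  have ml: "(MIN k\<in>{0..K-1}. \<integral>w. (norm (riemannian_grad (joint_manifold G special_orthogonal) (cost G) (x k w)))\<^sup>2 \<partial>P)
      \<le> 2 * real CARD('n) * (cost G x0 - fstar) / (\<gamma> * real K)"
    if "2 * \<rho> * \<alpha>\<^sup>2 * B\<^sup>2 * L\<^sup>2 * \<gamma>b\<^sup>2 + L * \<gamma>b - 1 \<le> 0" "0 < \<gamma>" "\<gamma> \<le> \<gamma>b"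
      "\<forall>i. manifold_retraction (robot_manifold G special_orthogonal i) (Retr i)"
      "descent_constant G special_orthogonal Retr L" "retr_bound G special_orthogonal Retr \<alpha>"
      "\<forall>y\<in>joint_manifold G special_orthogonal. fstar \<le> cost G y"
      "x0 \<in> joint_manifold G special_orthogonal"
      "asapp_iteration G special_orthogonal Retr \<gamma> (space P) idx delay x0 x"
      "bounded_delay G (space P) idx delay B" "K \<ge> 1"
    for \<gamma>b \<gamma> fstar delay K and x0 :: "('d, 'd, 'v) config" and x Retr
    by (rule asapp_rate[OF subspace_tangent_space_special_orthogonal idx alpha B that(2)
          step_size[OF that(1-3)] spec[OF that(4)] that(5,6) bspec[OF that(7)] that(8-11)])
  have relaxed: "(MIN k\<in>{0..K-1}. \<integral>w. (norm (riemannian_grad (joint_manifold G stiefel) (cost G) (x k w)))\<^sup>2 \<partial>P)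
      \<le> 2 * real CARD('n) * (cost G x0 - fstar) / (\<gamma> * real K)"
    if "2 * \<rho> * \<alpha>\<^sup>2 * B\<^sup>2 * L\<^sup>2 * \<gamma>b\<^sup>2 + L * \<gamma>b - 1 \<le> 0" "0 < \<gamma>" "\<gamma> \<le> \<gamma>b"
      "\<forall>i. manifold_retraction (robot_manifold G stiefel i) (Retr i)"
      "descent_constant G stiefel Retr L" "retr_bound G stiefel Retr \<alpha>"
      "\<forall>y\<in>(joint_manifold G stiefel :: ('d, 'r, 'v) config set). fstar \<le> cost G y"
      "x0 \<in> joint_manifold G stiefel"
      "asapp_iteration G stiefel Retr \<gamma> (space P) idx delay x0 x"
      "bounded_delay G (space P) idx delay B" "K \<ge> 1"
    for \<gamma>b \<gamma> fstar delay K and x0 :: "('d, 'r::finite, 'v) config" and x Retr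
    by (rule asapp_rate[OF subspace_tangent_space_stiefel idx alpha B that(2)
          step_size[OF that(1-3)] spec[OF that(4)] that(5,6) bspec[OF that(7)] that(8-11)])
  show ?thesis
    unfolding Let_def
    by (rule conjI[OF choice]) (intro allI impI conjI; elim conjE; rule ml relaxed; assumption)
qed

end
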